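(* There exist constants $C=C(\pi,q,\delta)$ and $C_1=C_1(\pi,q,\delta,\xi)$ such that the following holds for the broadcast process whose transition matrix $P$ satisfies $\|P_i-P_j\|_1\ge\delta q\lambda_2$ for all $i\neq j$ ($P_i$ the $i$-th row) and $\min_{i,j}P_{ij}>\xi$, with invertible noise matrix $\Delta$. If $$\frac{2\sqrt2\,\max_k\pi_k^{3/2}\max_k\pi_k^{-3/2}}{\xi^3}\,\lambda_2<\frac{\delta^2q^2}{8},\qquad \lambda_2^2d>C_1,$$ and the communities are $\delta$-distinguishable by $\{\xi_i:\lambda_i^2d>C\}$, then for all $i,j\in[q]$, $$\lim_{n\to\infty}\mathbb E\big[X_\rho^{(n)}(i)-\tilde X_\rho^{(n)}(i)\,\big|\,\sigma_\rho=j\big]=0.$$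
   Context: Fix $q\ge2$, a probability distribution $\pi$ on $[q]$ with all $\pi_i>0$, $D_\pi=\mathrm{diag}(\pi)$, scalars $\delta,\xi>0$, $d>0$. $P$ is a $q\times q$ stochastic matrix reversible with respect to $\pi$, with eigenvalues assumed to satisfy $1=\lambda_1\ge\lambda_2\ge\dots\ge\lambda_q\ge0$. $P=V^{-1}\Lambda V$ with $V=UD_\pi^{1/2}$, $U$ orthogonal with rows $u_\ell$; the eigenvector for $\lambda_\ell$ is $\xi_\ell(i)=\pi_i^{-1/2}u_\ell(i)$ (not to be confused with the scalar $\xi$). The communities are $\delta$-distinguishable by a set of vectors $\{v_k\}$ if for all $i\ne j$ in $[q]$ there is $k$ with $|v_k(i)-v_k(j)|>\delta$. Broadcast process: $T$ is a Galton–Watson tree with Poisson($d$) offspring and root $\rho$; $\sigma_\rho\sim\pi$; each child of a vertex with label $i$ independently gets label $j$ with probability $P_{ij}$. $L_m(u)$ is the $m$-th level of the subtree rooted at $u$. Noisy labels: given $\sigma$, independently for each $u$, $\mathbb P(\tau_u=j\mid\sigma_u=i)=\Delta_{ij}$. The tree is observed, and $X_u^{(m)}(i)=\mathbb P(\sigma_u=i\mid\sigma_{L_m(u)})$, $\tilde X_u^{(m)}(i)=\mathbb P(\sigma_u=i\mid\tau_{L_m(u)})$. *)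

theory Defs
  imports "HOL-Probability.Probability"
begin

section \<open>Transition matrices and their spectral decomposition\<close>

text \<open>
  The label set \<open>[q]\<close> is a finite linearly ordered type \<open>'q\<close> with \<open>CARD('q) = q\<close>. The order is
  only used to index the eigenvalues \<open>\<lambda>\<^sub>1 \<ge> \<dots> \<ge> \<lambda>\<^sub>q\<close> by \<open>[q]\<close>.
\<close>

type_synonym 'q rvec = "(real, 'q) vec"
type_synonym 'q rmat = "((real, 'q) vec, 'q) vec"

text \<open>The \<open>k\<close>-th element of the index type, counting from 1.\<close>

definition nth_index :: "nat \<Rightarrow> 'q :: {finite, linorder}" where
  "nth_index k = sorted_list_of_set UNIV ! (k - 1)"

definition diag :: "'q :: finite rvec \<Rightarrow> 'q rmat" where
  "diag v = (\<chi> i j. if i = j then v $ i else 0)"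

definition stochastic_matrix :: "'q :: finite rmat \<Rightarrow> bool" where
  "stochastic_matrix A \<longleftrightarrow> (\<forall>i j. A $ i $ j \<ge> 0) \<and> (\<forall>i. (\<Sum>j\<in>UNIV. A $ i $ j) = 1)"

definition reversible :: "'q :: finite pmf \<Rightarrow> 'q rmat \<Rightarrow> bool" where
  "reversible \<pi> P \<longleftrightarrow> (\<forall>i j. pmf \<pi> i * P $ i $ j = pmf \<pi> j * P $ j $ i)"

text \<open>\<open>P = V\<^sup>-\<^sup>1 \<Lambda> V\<close> with \<open>V = U D\<^sub>\<pi>\<^sup>1\<^sup>/\<^sup>2\<close>, \<open>U\<close> orthogonal, and \<open>\<Lambda>\<close> the diagonal matrix of the eigenvalues.\<close>

definition spectral_decomposition ::
  "'q :: finite pmf \<Rightarrow> 'q rmat \<Rightarrow> 'q rmat \<Rightarrow> 'q rvec \<Rightarrow> bool" where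
  "spectral_decomposition \<pi> P U l \<longleftrightarrow> orthogonal_matrix U \<and>
     (let V = U ** diag (\<chi> i. sqrt (pmf \<pi> i)) in P = matrix_inv V ** diag l ** V)"

text \<open>The eigenvector of \<open>P\<close> belonging to the \<open>k\<close>-th eigenvalue; \<open>U $ k\<close> is the \<open>k\<close>-th row of \<open>U\<close>.\<close>

definition eigvec :: "'q :: finite pmf \<Rightarrow> 'q rmat \<Rightarrow> 'q \<Rightarrow> 'q rvec" where
  "eigvec \<pi> U k = (\<chi> i. pmf \<pi> i powr (-1/2) * U $ k $ i)"

definition distinguishable :: "real \<Rightarrow> 'q :: finite rvec set \<Rightarrow> bool" where
  "distinguishable \<delta> S \<longleftrightarrow> (\<forall>i j. i \<noteq> j \<longrightarrow> (\<exists>v\<in>S. \<bar>v $ i - v $ j\<bar> > \<delta>))"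


section \<open>The broadcast process\<close>

text \<open>The \<open>i\<close>-th row of a stochastic matrix as a distribution (unspecified for other matrices).\<close>

definition row_pmf :: "'q rmat \<Rightarrow> 'q \<Rightarrow> 'q :: finite pmf" where
  "row_pmf A i = embed_pmf (\<lambda>j. A $ i $ j)"

lemma pmf_row_pmf:
  assumes "stochastic_matrix A"
  shows "pmf (row_pmf A i) j = A $ i $ j"
  unfolding row_pmf_def
proof (rule pmf_embed_pmf)
  show "\<And>x. 0 \<le> A $ i $ x"
    using assms by (simp add: stochastic_matrix_def)
  have "(\<integral>\<^sup>+x. ennreal (A $ i $ x) \<partial>count_space UNIV) = (\<Sum>x\<in>UNIV. ennreal (A $ i $ x))"
    by (simp add: nn_integral_count_space_finite)
  also have "\<dots> = ennreal (\<Sum>x\<in>UNIV. A $ i $ x)"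
    using assms by (intro sum_ennreal) (simp add: stochastic_matrix_def)
  finally show "(\<integral>\<^sup>+x. ennreal (A $ i $ x) \<partial>count_space UNIV) = 1"
    using assms by (simp add: stochastic_matrix_def)
qed

datatype 'a tree = Node (root: 'a) (children: "'a tree list")

text \<open>
  The joint law of the first \<open>n\<close> levels of the Galton--Watson tree with Poisson(\<open>d\<close>) offspring,
  the broadcast labels \<open>\<sigma>\<close> and the noisy labels \<open>\<tau>\<close>, given that the root has label \<open>i\<close>.
  Every vertex \<open>u\<close> carries the pair \<open>(\<sigma>\<^sub>u, \<tau>\<^sub>u)\<close>. By \<open>broadcast_consistent\<close> below, these laws are the
  marginals of one process on the infinite tree.
\<close>

fun broadcast_from ::
  "real \<Rightarrow> 'q rmat \<Rightarrow> 'q rmat \<Rightarrow> nat \<Rightarrow> 'q \<Rightarrow> ('q :: finite \<times> 'q) tree pmf" where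
  "broadcast_from d P \<Delta> 0 i = do {
     t \<leftarrow> row_pmf \<Delta> i;
     return_pmf (Node (i, t) [])
   }"
| "broadcast_from d P \<Delta> (Suc n) i = do {
     t \<leftarrow> row_pmf \<Delta> i;
     k \<leftarrow> poisson_pmf d;
     ts \<leftarrow> replicate_pmf k (do {j \<leftarrow> row_pmf P i; broadcast_from d P \<Delta> n j});
     return_pmf (Node (i, t) ts)
   }"

definition broadcast ::
  "'q pmf \<Rightarrow> real \<Rightarrow> 'q rmat \<Rightarrow> 'q rmat \<Rightarrow> nat \<Rightarrow> ('q :: finite \<times> 'q) tree pmf" where
  "broadcast \<pi> d P \<Delta> n = do {i \<leftarrow> \<pi>; broadcast_from d P \<Delta> n i}"

fun truncate_tree :: "nat \<Rightarrow> 'a tree \<Rightarrow> 'a tree" where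
  "truncate_tree 0 (Node a ts) = Node a []"
| "truncate_tree (Suc n) (Node a ts) = Node a (map (truncate_tree n) ts)"

lemma map_map_replicate_pmf:
  "map_pmf (map f) (replicate_pmf k p) = replicate_pmf k (map_pmf f p)"
proof (induction k)
  case (Suc k)
  have "map_pmf (map f) (replicate_pmf (Suc k) p) =
      do {x \<leftarrow> p; xs \<leftarrow> map_pmf (map f) (replicate_pmf k p); return_pmf (f x # xs)}"
    by (simp add: map_bind_pmf bind_map_pmf)
  then show ?case
    unfolding Suc.IH by (simp add: bind_map_pmf)
qed simp

lemma broadcast_from_consistent:
  "map_pmf (truncate_tree n) (broadcast_from d P \<Delta> (Suc n) i) = broadcast_from d P \<Delta> n i"
proof (induction n arbitrary: i)
  case 0
  show ?case
    by (simp add: map_bind_pmf)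
next
  case (Suc n)
  define R where "R = do {j \<leftarrow> row_pmf P i; broadcast_from d P \<Delta> (Suc n) j}"
  have R: "map_pmf (truncate_tree n) R = do {j \<leftarrow> row_pmf P i; broadcast_from d P \<Delta> n j}"
    unfolding R_def map_bind_pmf Suc.IH ..
  have "map_pmf (truncate_tree (Suc n)) (broadcast_from d P \<Delta> (Suc (Suc n)) i) =
      do {t \<leftarrow> row_pmf \<Delta> i; k \<leftarrow> poisson_pmf d; ts \<leftarrow> replicate_pmf k R;
          return_pmf (Node (i, t) (map (truncate_tree n) ts))}"
    unfolding R_def broadcast_from.simps(2)[of d P \<Delta> "Suc n"]
    by (simp add: map_bind_pmf del: broadcast_from.simps)
  also have "\<dots> = do {t \<leftarrow> row_pmf \<Delta> i; k \<leftarrow> poisson_pmf d;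
      ts \<leftarrow> map_pmf (map (truncate_tree n)) (replicate_pmf k R); return_pmf (Node (i, t) ts)}"
    by (simp add: bind_map_pmf)
  also have "\<dots> = broadcast_from d P \<Delta> (Suc n) i"
    unfolding map_map_replicate_pmf R by simp
  finally show ?case .
qed

lemma broadcast_consistent:
  "map_pmf (truncate_tree n) (broadcast \<pi> d P \<Delta> (Suc n)) = broadcast \<pi> d P \<Delta> n"
  by (simp add: broadcast_def map_bind_pmf broadcast_from_consistent del: broadcast_from.simps)


section \<open>Posterior of the root label\<close>

text \<open>
  What an observer of the tree and of the labels on level \<open>n\<close> sees: the label \<open>f a\<close> at every vertex of
  level \<open>n\<close>, and only the shape of the tree elsewhere.
\<close>

fun reveal_level :: "('a \<Rightarrow> 'b) \<Rightarrow> nat \<Rightarrow> 'a tree \<Rightarrow> 'b option tree" where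
  "reveal_level f 0 (Node a ts) = Node (Some (f a)) (map (map_tree (\<lambda>_. None)) ts)"
| "reveal_level f (Suc n) (Node a ts) = Node None (map (reveal_level f n) ts)"

text \<open>
  The posterior probability that the root label is \<open>i\<close>, given the tree and the labels on level \<open>n\<close>, as a
  random variable on \<open>broadcast \<pi> d P \<Delta> n\<close>. Given the first \<open>n\<close> levels of the tree, its continuation beyond level \<open>n\<close> is independent of all labels up to level \<open>n\<close>; hence
  observing the shape of the first \<open>n\<close> levels amounts to observing the whole tree.
\<close>

definition posterior ::
  "('q \<times> 'q \<Rightarrow> 'q) \<Rightarrow> 'q pmf \<Rightarrow> real \<Rightarrow> 'q rmat \<Rightarrow> 'q rmat \<Rightarrow> nat \<Rightarrow> 'q
    \<Rightarrow> ('q :: finite \<times> 'q) tree \<Rightarrow> real" where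
  "posterior f \<pi> d P \<Delta> n i \<omega> =
     \<P>(t in broadcast \<pi> d P \<Delta> n. fst (root t) = i \<bar> reveal_level f n t = reveal_level f n \<omega>)"

text \<open>\<open>X_root\<close> uses the true labels \<open>\<sigma>\<close> on level \<open>n\<close>, \<open>X_noisy\<close> (usually
  written with a tilde) the noisy labels \<open>\<tau>\<close>.\<close>

abbreviation "X_root \<equiv> posterior fst"
abbreviation "X_noisy \<equiv> posterior snd"

end

theory Submission
  imports Defs
begin

text \<open>
  Let \<open>Z\<^sub>n(i, j)\<close> and \<open>Z\<^sub>n'(i, j)\<close> be the Bhattacharyya coefficients of the laws of the observation of level \<open>n\<close>,
  without and with noise, given the root labels \<open>i\<close> and \<open>j\<close>. For Poisson offspring
  \<open>Z\<^sub>n\<^sub>+\<^sub>1(i, j) = exp (- d * (1 - z))\<close>, where \<open>z\<close> is the coefficient of the mixtures of the level \<open>n\<close> laws with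
  weights \<open>P\<^sub>i\<close> and \<open>P\<^sub>j\<close>; similarly \<open>z'\<close> with noise. The noisy observation is the image of the noiseless one under a
  kernel that does not depend on the root label, so the differences \<open>Z\<^sub>n' - Z\<^sub>n\<close> and \<open>z' - z\<close> are mean Bregman
  divergences of \<open>(u, v) \<mapsto> sqrt (u * v)\<close>. Both are comparable to the mean square distance \<open>D\<close> of the two posteriors:
  \<open>D \<le> 8 * (\<Sum>k l. Z\<^sub>n'(k, l) - Z\<^sub>n(k, l))\<close> and \<open>z' - z \<le> K * \<lambda>\<^sub>2\<^sup>2 * D\<close>, the latter because \<open>P\<close> contracts mean zero
  vectors by the factor \<open>\<lambda>\<^sub>2\<close>. A census estimator, the linear statistic of the noisy labels built from an
  eigenvector, makes all \<open>Z\<^sub>n'(i, j)\<close> with \<open>i \<noteq> j\<close> small for large \<open>n\<close> (Chebyshev), and then the separation of the rows of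
  \<open>P\<close> gives \<open>1 - z' \<ge> c * \<lambda>\<^sub>2\<^sup>2\<close>. Hence the total gap contracts by a factor of order
  \<open>\<lambda>\<^sub>2\<^sup>2 * d * exp (- c * \<lambda>\<^sub>2\<^sup>2 * d)\<close> per level, which is at most \<open>1/2\<close> if \<open>\<lambda>\<^sub>2\<^sup>2 * d\<close> is large.
\<close>

section \<open>Compound Poisson sums\<close>

lemma has_bochner_integral_bind_pmf_nonneg:
  fixes g :: "'b \<Rightarrow> real"
  assumes int: "\<And>x. x \<in> set_pmf M \<Longrightarrow> integrable (measure_pmf (N x)) g"
    and int': "integrable (measure_pmf M) (\<lambda>x. \<integral>y. g y \<partial>measure_pmf (N x))"
    and nonneg: "\<And>y. 0 \<le> g y"
  shows "has_bochner_integral (measure_pmf (bind_pmf M N)) g (\<integral>x. \<integral>y. g y \<partial>measure_pmf (N x) \<partial>measure_pmf M)"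
proof (rule has_bochner_integral_nn_integral)
  have "(\<integral>\<^sup>+y. ennreal (g y) \<partial>measure_pmf (bind_pmf M N)) =
      (\<integral>\<^sup>+x. \<integral>\<^sup>+y. ennreal (g y) \<partial>measure_pmf (N x) \<partial>measure_pmf M)"
    by simp
  also have "\<dots> = (\<integral>\<^sup>+x. ennreal (\<integral>y. g y \<partial>measure_pmf (N x)) \<partial>measure_pmf M)"
    by (intro nn_integral_cong_AE) (auto simp: AE_measure_pmf_iff int nonneg nn_integral_eq_integral)
  also have "\<dots> = ennreal (\<integral>x. \<integral>y. g y \<partial>measure_pmf (N x) \<partial>measure_pmf M)"
    by (intro nn_integral_eq_integral int') (simp add: nonneg)
  finally show "(\<integral>\<^sup>+y. ennreal (g y) \<partial>measure_pmf (bind_pmf M N)) = \<dots>" .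
qed (auto simp: nonneg)

text \<open>The nonnegative case is applied to \<open>\<bar>f y\<bar>\<close> and to
  \<open>\<bar>f y\<bar> - f y\<close>, whose difference is \<open>f y\<close>.\<close>

lemma has_bochner_integral_bind_pmf:
  fixes f :: "'b \<Rightarrow> real"
  assumes int: "\<And>x. x \<in> set_pmf M \<Longrightarrow> integrable (measure_pmf (N x)) f"
    and int': "integrable (measure_pmf M) (\<lambda>x. \<integral>y. \<bar>f y\<bar> \<partial>measure_pmf (N x))"
  shows "has_bochner_integral (measure_pmf (bind_pmf M N)) f (\<integral>x. \<integral>y. f y \<partial>measure_pmf (N x) \<partial>measure_pmf M)"
proof -
  define A where "A = (\<lambda>x. \<integral>y. \<bar>f y\<bar> \<partial>measure_pmf (N x))"
  define F where "F = (\<lambda>x. \<integral>y. f y \<partial>measure_pmf (N x))"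
  have intF: "integrable (measure_pmf M) F"
    using int' by (rule Bochner_Integration.integrable_bound) (auto simp: F_def)
  have eq: "(\<integral>y. \<bar>f y\<bar> - f y \<partial>measure_pmf (N x)) = A x - F x" if "x \<in> set_pmf M" for x
    unfolding A_def F_def using int[OF that] by (intro Bochner_Integration.integral_diff) auto
  have "integrable (measure_pmf M) (\<lambda>x. \<integral>y. \<bar>f y\<bar> - f y \<partial>measure_pmf (N x)) \<longleftrightarrow>
      integrable (measure_pmf M) (\<lambda>x. A x - F x)"
    by (intro integrable_cong_AE) (auto simp: AE_measure_pmf_iff eq)
  then have int2: "integrable (measure_pmf M) (\<lambda>x. \<integral>y. \<bar>f y\<bar> - f y \<partial>measure_pmf (N x))"
    using int' intF by (simp add: A_def)
  have "has_bochner_integral (measure_pmf (bind_pmf M N)) (\<lambda>y. \<bar>f y\<bar> - (\<bar>f y\<bar> - f y))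
      ((\<integral>x. A x \<partial>measure_pmf M) - (\<integral>x. \<integral>y. \<bar>f y\<bar> - f y \<partial>measure_pmf (N x) \<partial>measure_pmf M))"
    unfolding A_def using int int' int2
    by (intro has_bochner_integral_diff has_bochner_integral_bind_pmf_nonneg) auto
  moreover have "(\<integral>x. \<integral>y. \<bar>f y\<bar> - f y \<partial>measure_pmf (N x) \<partial>measure_pmf M) = (\<integral>x. A x - F x \<partial>measure_pmf M)"
    by (intro integral_cong_AE) (auto simp: AE_measure_pmf_iff eq)
  moreover have "\<dots> = (\<integral>x. A x \<partial>measure_pmf M) - (\<integral>x. F x \<partial>measure_pmf M)"
    using int' intF by (simp add: A_def)
  ultimately show ?thesis by (simp add: F_def)
qed

section \<open>Moments and generating function of the Poisson law\<close>

text \<open>Size biasing: the weight at \<open>Suc k\<close> times \<open>Suc k\<close> is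
  \<open>d\<close> times the weight at \<open>k\<close>, and the term at 0 vanishes. Taking
  \<open>f\<close> to be 1 and then the identity yields the first two moments.\<close>

lemma nn_integral_poisson_pmf_times:
  assumes "0 < d"
  shows "(\<integral>\<^sup>+k. ennreal (real k) * f k \<partial>measure_pmf (poisson_pmf d)) =
    ennreal d * (\<integral>\<^sup>+k. f (Suc k) \<partial>measure_pmf (poisson_pmf d))"
proof -
  let ?p = "pmf (poisson_pmf d)"
  have step: "ennreal (?p (Suc k)) * (ennreal (real (Suc k)) * f (Suc k)) = ennreal d * (ennreal (?p k) * f (Suc k))" for k
  proof -
    have "?p (Suc k) * real (Suc k) = d * ?p k"
      using assms by (simp add: fact_Suc field_simps del: of_nat_Suc)
    then have "ennreal (?p (Suc k)) * ennreal (real (Suc k)) = ennreal d * ennreal (?p k)"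
      using assms by (metis ennreal_mult of_nat_0_le_iff order_less_imp_le pmf_nonneg)
    then show ?thesis by (simp add: mult.assoc[symmetric] del: pmf_poisson)
  qed
  have "(\<integral>\<^sup>+k. ennreal (real k) * f k \<partial>measure_pmf (poisson_pmf d)) =
      (\<Sum>k. ennreal (?p k) * (ennreal (real k) * f k))"
    by (simp add: nn_integral_measure_pmf nn_integral_count_space_nat del: pmf_poisson)
  also have "\<dots> = (\<Sum>k. ennreal (?p (Suc k)) * (ennreal (real (Suc k)) * f (Suc k)))"
    by (subst suminf_offset[where i = 1]) (auto simp del: pmf_poisson)
  also have "\<dots> = (\<Sum>k. ennreal d * (ennreal (?p k) * f (Suc k)))"
    by (simp only: step)
  also have "\<dots> = ennreal d * (\<integral>\<^sup>+k. f (Suc k) \<partial>measure_pmf (poisson_pmf d))"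
    by (simp add: nn_integral_measure_pmf nn_integral_count_space_nat del: pmf_poisson)
  finally show ?thesis .
qed

lemma has_bochner_integral_poisson_pmf:
  assumes "0 < d"
  shows "has_bochner_integral (measure_pmf (poisson_pmf d)) real d"
proof (rule has_bochner_integral_nn_integral)
  show "(\<integral>\<^sup>+k. ennreal (real k) \<partial>measure_pmf (poisson_pmf d)) = ennreal d"
    using nn_integral_poisson_pmf_times[OF assms, of "\<lambda>_. 1"] by simp
qed (use assms in auto)

lemma has_bochner_integral_poisson_pmf_square:
  assumes "0 < d"
  shows "has_bochner_integral (measure_pmf (poisson_pmf d)) (\<lambda>k. (real k)\<^sup>2) (d\<^sup>2 + d)"
proof (rule has_bochner_integral_nn_integral)
  have "(\<integral>\<^sup>+k. ennreal ((real k)\<^sup>2) \<partial>measure_pmf (poisson_pmf d)) =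
      (\<integral>\<^sup>+k. ennreal (real k) * ennreal (real k) \<partial>measure_pmf (poisson_pmf d))"
    by (simp add: power2_eq_square ennreal_mult)
  also have "\<dots> = ennreal d * (\<integral>\<^sup>+k. 1 + ennreal (real k) \<partial>measure_pmf (poisson_pmf d))"
    unfolding nn_integral_poisson_pmf_times[OF assms] by (simp add: ennreal_plus)
  also have "\<dots> = ennreal d * (1 + ennreal d)"
    using nn_integral_poisson_pmf_times[OF assms, of "\<lambda>_. 1"] by (simp add: nn_integral_add)
  also have "\<dots> = ennreal (d\<^sup>2 + d)"
    using assms by (simp add: distrib_left power2_eq_square ennreal_plus ennreal_mult add.commute)
  finally show "(\<integral>\<^sup>+k. ennreal ((real k)\<^sup>2) \<partial>measure_pmf (poisson_pmf d)) = \<dots>" .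
qed (use assms in auto)

text \<open>The exponential series. The base \<open>c\<close> will be a Bhattacharyya coefficient,
  and the formula then sums over the number of children of a vertex.\<close>

lemma nn_integral_poisson_pmf_power:
  assumes "0 < d" "0 \<le> c"
  shows "(\<integral>\<^sup>+k. ennreal (c ^ k) \<partial>measure_pmf (poisson_pmf d)) = ennreal (exp (- d * (1 - c)))"
proof -
  have "(\<lambda>k. exp (-d) * ((d * c) ^ k /\<^sub>R fact k)) sums (exp (-d) * exp (d * c))"
    by (intro sums_mult exp_converges)
  then have s: "(\<lambda>k. pmf (poisson_pmf d) k * c ^ k) sums exp (- d * (1 - c))"
    using assms by (simp add: power_mult_distrib field_simps exp_add[symmetric])
  have "(\<integral>\<^sup>+k. ennreal (c ^ k) \<partial>measure_pmf (poisson_pmf d)) = (\<Sum>k. ennreal (pmf (poisson_pmf d) k * c ^ k))"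
    using assms by (simp add: nn_integral_measure_pmf nn_integral_count_space_nat ennreal_mult' del: pmf_poisson)
  also have "\<dots> = ennreal (exp (- d * (1 - c)))"
    using assms s by (intro suminf_ennreal_eq) (auto simp del: pmf_poisson)
  finally show ?thesis .
qed

section \<open>Lists of a Poisson number of independent samples\<close>

text \<open>The list is kept instead of the sum of its entries because it serves as the law of the
  list of subtrees below a vertex.\<close>

definition compound_poisson :: "real \<Rightarrow> 'a pmf \<Rightarrow> 'a list pmf" where
  "compound_poisson d p = do {k \<leftarrow> poisson_pmf d; replicate_pmf k p}"

lemma pmf_replicate_pmf:
  "pmf (replicate_pmf k p) xs = (if length xs = k then prod_list (map (pmf p) xs) else 0)"
proof (induction k arbitrary: xs)
  case (Suc k)
  show ?case
  proof (cases xs)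
    case Nil
    have "[] \<notin> set_pmf (replicate_pmf (Suc k) p)"
      by auto
    then show ?thesis unfolding Nil set_pmf_iff by simp
  next
    case (Cons a ys)
    have eq: "replicate_pmf (Suc k) p = map_pmf (\<lambda>(x, xs). x # xs) (pair_pmf p (replicate_pmf k p))"
      by (simp add: pair_pmf_def map_bind_pmf)
    have "inj (\<lambda>(x::'a, xs). x # xs)"
      by (auto simp: inj_def)
    from pmf_map_inj'[OF this, of "pair_pmf p (replicate_pmf k p)" "(a, ys)"] show ?thesis
      unfolding eq Cons by (simp add: Suc pmf_pair)
  qed
qed (auto simp: pmf_return indicator_def)

lemma pmf_compound_poisson:
  assumes "0 < d"
  shows "pmf (compound_poisson d p) xs = pmf (poisson_pmf d) (length xs) * prod_list (map (pmf p) xs)"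
proof -
  have "pmf (compound_poisson d p) xs = (\<integral>k. (if length xs = k then prod_list (map (pmf p) xs) else 0) \<partial>measure_pmf (poisson_pmf d))"
    by (simp add: compound_poisson_def pmf_bind pmf_replicate_pmf)
  also have "\<dots> = (\<Sum>k\<in>{length xs}. (if length xs = k then prod_list (map (pmf p) xs) else 0) * pmf (poisson_pmf d) k)"
    by (rule integral_measure_pmf_real) (auto split: if_splits)
  finally show ?thesis by (simp add: mult.commute)
qed

lemma nn_integral_replicate_pmf_prod:
  "(\<integral>\<^sup>+xs. prod_list (map g xs) \<partial>measure_pmf (replicate_pmf k p)) = (\<integral>\<^sup>+x. g x \<partial>measure_pmf p) ^ k"
  by (induction k) (auto simp: nn_integral_cmult nn_integral_multc)

text \<open>\<open>L\<close> applies \<open>K\<close> independently to every entry and reads the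
  length off the list. One \<open>L\<close> therefore serves all \<open>k\<close> and
  \<open>p\<close>, which keeps the noise kernel of a level independent of the root label.\<close>

lemma bind_replicate_pmf:
  fixes K :: "'a \<Rightarrow> 'b pmf"
  shows "\<exists>L. \<forall>k p. bind_pmf (replicate_pmf k p) L = replicate_pmf k (bind_pmf p K)"
proof -
  define L :: "'a list \<Rightarrow> 'b list pmf" where
    "L = rec_list (return_pmf []) (\<lambda>x _ r. do {y \<leftarrow> K x; ys \<leftarrow> r; return_pmf (y # ys)})"
  have "bind_pmf (replicate_pmf k p) L = replicate_pmf k (bind_pmf p K)" for k p
  proof (induction k)
    case (Suc k)
    have "bind_pmf (replicate_pmf (Suc k) p) L =
        do {x \<leftarrow> p; xs \<leftarrow> replicate_pmf k p; y \<leftarrow> K x; ys \<leftarrow> L xs; return_pmf (y # ys)}"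
      by (simp add: bind_assoc_pmf bind_return_pmf L_def)
    also have "\<dots> = do {x \<leftarrow> p; y \<leftarrow> K x; xs \<leftarrow> replicate_pmf k p; ys \<leftarrow> L xs; return_pmf (y # ys)}"
      by (subst bind_commute_pmf[of "replicate_pmf k p"]) simp
    also have "\<dots> = do {x \<leftarrow> p; y \<leftarrow> K x; ys \<leftarrow> bind_pmf (replicate_pmf k p) L; return_pmf (y # ys)}"
      by (simp add: bind_assoc_pmf)
    finally show ?case
      unfolding Suc.IH by (simp add: bind_assoc_pmf)
  qed (simp add: L_def bind_return_pmf)
  then show ?thesis by blast
qed

text \<open>Additivity of mean and variance over independent samples, where
  \<open>w - \<mu>\<^sup>2\<close> is the variance of one sample. The induction conditions on the
  first sample.\<close>

lemma replicate_pmf_moments: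
  fixes f :: "'a \<Rightarrow> real"
  assumes "integrable (measure_pmf p) f" "integrable (measure_pmf p) (\<lambda>x. (f x)\<^sup>2)"
    and \<mu>: "(\<integral>x. f x \<partial>measure_pmf p) = \<mu>" and w: "(\<integral>x. (f x)\<^sup>2 \<partial>measure_pmf p) = w"
  shows "has_bochner_integral (measure_pmf (replicate_pmf k p)) (\<lambda>xs. sum_list (map f xs)) (k * \<mu>) \<and>
    has_bochner_integral (measure_pmf (replicate_pmf k p)) (\<lambda>xs. (sum_list (map f xs))\<^sup>2) (k * (w - \<mu>\<^sup>2) + (k * \<mu>)\<^sup>2)"
proof (induction k)
  case 0
  show ?case by (auto simp: has_bochner_integral_iff integrable_measure_pmf_finite)
next
  case (Suc k)
  let ?S = "\<lambda>xs. sum_list (map f xs)"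
  let ?R = "measure_pmf (replicate_pmf k p)"
  have eq: "replicate_pmf (Suc k) p = bind_pmf p (\<lambda>x. map_pmf ((#) x) (replicate_pmf k p))"
    by (simp add: map_pmf_def)
  have i1: "integrable ?R ?S" and e1: "(\<integral>xs. ?S xs \<partial>?R) = k * \<mu>"
    and i2: "integrable ?R (\<lambda>xs. (?S xs)\<^sup>2)" and e2: "(\<integral>xs. (?S xs)\<^sup>2 \<partial>?R) = k * (w - \<mu>\<^sup>2) + (k * \<mu>)\<^sup>2"
    using Suc by (auto simp: has_bochner_integral_iff)
  have sq: "(f x + ?S xs)\<^sup>2 = (f x)\<^sup>2 + (2 * f x * ?S xs + (?S xs)\<^sup>2)" for x xs
    by (simp add: power2_sum)
  have inner: "(\<integral>xs. (f x + ?S xs)\<^sup>2 \<partial>?R) = (f x)\<^sup>2 + (2 * f x * (k * \<mu>) + (k * (w - \<mu>\<^sup>2) + (k * \<mu>)\<^sup>2))" for x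
    unfolding sq using i1 i2 by (simp add: e1 e2)
  \<comment> \<open>Domination by \<open>\<bar>f x\<bar>\<close> plus a constant gives the absolute
    integrability that \<open>has_bochner_integral_bind_pmf\<close> asks for.\<close>
  have abs: "integrable (measure_pmf p) (\<lambda>x. \<integral>xs. \<bar>f x + ?S xs\<bar> \<partial>?R)"
  proof (rule Bochner_Integration.integrable_bound)
    show "integrable (measure_pmf p) (\<lambda>x. \<bar>f x\<bar> + (\<integral>xs. \<bar>?S xs\<bar> \<partial>?R))"
      using assms by auto
    have "(\<integral>xs. \<bar>f x + ?S xs\<bar> \<partial>?R) \<le> (\<integral>xs. \<bar>f x\<bar> + \<bar>?S xs\<bar> \<partial>?R)" for x
      using i1 by (intro integral_mono) auto
    then have "(\<integral>xs. \<bar>f x + ?S xs\<bar> \<partial>?R) \<le> \<bar>f x\<bar> + (\<integral>xs. \<bar>?S xs\<bar> \<partial>?R)" for x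
      using i1 by simp
    then show "AE x in measure_pmf p. norm (\<integral>xs. \<bar>f x + ?S xs\<bar> \<partial>?R) \<le> norm (\<bar>f x\<bar> + (\<integral>xs. \<bar>?S xs\<bar> \<partial>?R))"
      by (auto intro!: AE_I2 order_trans[OF _ abs_ge_self])
  qed simp
  have m1: "has_bochner_integral (measure_pmf (replicate_pmf (Suc k) p)) ?S (\<integral>x. \<integral>xs. ?S xs \<partial>measure_pmf (map_pmf ((#) x) (replicate_pmf k p)) \<partial>measure_pmf p)"
    unfolding eq using i1 abs by (intro has_bochner_integral_bind_pmf) auto
  have m2: "has_bochner_integral (measure_pmf (replicate_pmf (Suc k) p)) (\<lambda>xs. (?S xs)\<^sup>2) (\<integral>x. \<integral>xs. (?S xs)\<^sup>2 \<partial>measure_pmf (map_pmf ((#) x) (replicate_pmf k p)) \<partial>measure_pmf p)"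
    unfolding eq using i1 i2 assms
    by (intro has_bochner_integral_bind_pmf_nonneg) (auto simp: inner, auto simp: sq)
  have v1: "(\<integral>x. \<integral>xs. ?S xs \<partial>measure_pmf (map_pmf ((#) x) (replicate_pmf k p)) \<partial>measure_pmf p) = real (Suc k) * \<mu>"
    using assms i1 by (simp add: e1 distrib_right)
  have v2: "(\<integral>x. \<integral>xs. (?S xs)\<^sup>2 \<partial>measure_pmf (map_pmf ((#) x) (replicate_pmf k p)) \<partial>measure_pmf p) =
     real (Suc k) * (w - \<mu>\<^sup>2) + (real (Suc k) * \<mu>)\<^sup>2"
    using assms by (simp add: inner) (simp add: algebra_simps power2_eq_square)
  show ?case using m1 m2 unfolding v1 v2 by blast
qed

text \<open>Law of total variance: the length has mean and variance \<open>d\<close>, so the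
  variance of the sum is \<open>d * (w - \<mu>\<^sup>2) + d * \<mu>\<^sup>2 = d * w\<close>.\<close>

lemma compound_poisson_moments:
  fixes f :: "'a \<Rightarrow> real"
  assumes d: "0 < d" and f: "integrable (measure_pmf p) f" "integrable (measure_pmf p) (\<lambda>x. (f x)\<^sup>2)"
    and \<mu>: "(\<integral>x. f x \<partial>measure_pmf p) = \<mu>" and w: "(\<integral>x. (f x)\<^sup>2 \<partial>measure_pmf p) = w"
  shows "has_bochner_integral (measure_pmf (compound_poisson d p)) (\<lambda>xs. sum_list (map f xs)) (d * \<mu>)"
    "has_bochner_integral (measure_pmf (compound_poisson d p)) (\<lambda>xs. (sum_list (map f xs))\<^sup>2) (d * w + (d * \<mu>)\<^sup>2)"
proof -
  let ?S = "\<lambda>xs. sum_list (map f xs)"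
  let ?P = "measure_pmf (poisson_pmf d)"
  note m = replicate_pmf_moments[OF f \<mu> w, unfolded has_bochner_integral_iff]
  have P: "integrable ?P real" "(\<integral>k. real k \<partial>?P) = d"
    "integrable ?P (\<lambda>k. (real k)\<^sup>2)" "(\<integral>k. (real k)\<^sup>2 \<partial>?P) = d\<^sup>2 + d"
    using has_bochner_integral_poisson_pmf[OF d] has_bochner_integral_poisson_pmf_square[OF d]
    by (auto simp: has_bochner_integral_iff)
  have abs: "integrable ?P (\<lambda>k. \<integral>xs. \<bar>?S xs\<bar> \<partial>measure_pmf (replicate_pmf k p))"
  proof (rule Bochner_Integration.integrable_bound)
    show "integrable ?P (\<lambda>k. 1 + (k * (w - \<mu>\<^sup>2) + (k * \<mu>)\<^sup>2))"
      using P by (simp add: power_mult_distrib)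
    \<comment> \<open>This bounds the absolute moment given the length by the second moment, which
      is a quadratic polynomial in \<open>k\<close>.\<close>
    have "\<bar>x\<bar> \<le> 1 + x\<^sup>2" for x :: real
      by (cases "\<bar>x\<bar> \<le> 1") (auto intro: order_trans[OF self_le_power[of "\<bar>x\<bar>" 2]] simp: add_increasing2)
    then have "(\<integral>xs. \<bar>?S xs\<bar> \<partial>measure_pmf (replicate_pmf k p)) \<le> (\<integral>xs. 1 + (?S xs)\<^sup>2 \<partial>measure_pmf (replicate_pmf k p))" for k
      using m by (intro integral_mono) auto
    then have "(\<integral>xs. \<bar>?S xs\<bar> \<partial>measure_pmf (replicate_pmf k p)) \<le> 1 + (k * (w - \<mu>\<^sup>2) + (k * \<mu>)\<^sup>2)" for k
      using m by simp
    then show "AE k in ?P. norm (\<integral>xs. \<bar>?S xs\<bar> \<partial>measure_pmf (replicate_pmf k p)) \<le> norm (1 + (k * (w - \<mu>\<^sup>2) + (k * \<mu>)\<^sup>2))"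
      by (auto intro!: AE_I2 order_trans[OF _ abs_ge_self])
  qed simp
  have "has_bochner_integral (measure_pmf (compound_poisson d p)) ?S (\<integral>k. \<integral>xs. ?S xs \<partial>measure_pmf (replicate_pmf k p) \<partial>?P)"
    unfolding compound_poisson_def using m abs by (intro has_bochner_integral_bind_pmf) auto
  then show "has_bochner_integral (measure_pmf (compound_poisson d p)) ?S (d * \<mu>)"
    using m P by simp
  have "has_bochner_integral (measure_pmf (compound_poisson d p)) (\<lambda>xs. (?S xs)\<^sup>2) (\<integral>k. \<integral>xs. (?S xs)\<^sup>2 \<partial>measure_pmf (replicate_pmf k p) \<partial>?P)"
    unfolding compound_poisson_def using m P
    by (intro has_bochner_integral_bind_pmf_nonneg) (auto simp: power_mult_distrib)
  moreover have "(\<integral>k. \<integral>xs. (?S xs)\<^sup>2 \<partial>measure_pmf (replicate_pmf k p) \<partial>?P) = d * w + (d * \<mu>)\<^sup>2"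
    using m P by (simp add: power_mult_distrib) (simp add: algebra_simps power2_eq_square)
  ultimately show "has_bochner_integral (measure_pmf (compound_poisson d p)) (\<lambda>xs. (?S xs)\<^sup>2) (d * w + (d * \<mu>)\<^sup>2)"
    by simp
qed

section \<open>The Bhattacharyya coefficient\<close>

text \<open>One minus the squared Hellinger distance (normalised by \<open>1/2\<close>); it is 0
  exactly for laws with disjoint supports.\<close>

definition bhattacharyya :: "'a pmf \<Rightarrow> 'a pmf \<Rightarrow> real" where
  "bhattacharyya p q = (\<integral>x. sqrt (pmf p x * pmf q x) \<partial>count_space UNIV)"

text \<open>The arithmetic-geometric mean inequality gives integrability. The \<open>ennreal\<close>
  form allows later computations without integrability conditions.\<close>

lemma ennreal_bhattacharyya:
  "ennreal (bhattacharyya p q) = (\<integral>\<^sup>+x. ennreal (sqrt (pmf p x * pmf q x)) \<partial>count_space UNIV)"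
proof -
  have "integrable (count_space UNIV) (\<lambda>x. sqrt (pmf p x * pmf q x))"
  proof (rule Bochner_Integration.integrable_bound)
    show "integrable (count_space UNIV) (\<lambda>x. pmf p x + pmf q x)"
      by (intro Bochner_Integration.integrable_add integrable_pmf)
    have "sqrt (pmf p x * pmf q x) \<le> pmf p x + pmf q x" for x
      using arith_geo_mean_sqrt[of "pmf p x" "pmf q x"] pmf_nonneg[of p x] pmf_nonneg[of q x]
      by (simp del: pmf_nonneg)
    then show "AE x in count_space UNIV. norm (sqrt (pmf p x * pmf q x)) \<le> norm (pmf p x + pmf q x)"
      by simp
  qed simp
  then show ?thesis
    unfolding bhattacharyya_def by (subst nn_integral_eq_integral) auto
qed

lemma bhattacharyya_nonneg [simp]: "0 \<le> bhattacharyya p q"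
  by (simp add: bhattacharyya_def)

lemma bhattacharyya_refl [simp]: "bhattacharyya p p = 1"
  by (simp add: bhattacharyya_def integral_pmf)

section \<open>Likelihood ratios with respect to a dominating law\<close>

text \<open>The density of \<open>p\<close> if \<open>m\<close> dominates it; division by zero makes
  it 0 outside the support of \<open>m\<close>.\<close>

definition likelihood_ratio :: "'a pmf \<Rightarrow> 'a pmf \<Rightarrow> 'a \<Rightarrow> real" where
  "likelihood_ratio p m x = pmf p x / pmf m x"

lemma likelihood_ratio_nonneg [simp]: "0 \<le> likelihood_ratio p m x"
  by (simp add: likelihood_ratio_def)

lemma pmf_times_likelihood_ratio:
  assumes "set_pmf p \<subseteq> set_pmf m"
  shows "pmf m x * likelihood_ratio p m x = pmf p x"
  using assms by (auto simp: likelihood_ratio_def set_pmf_iff)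

lemma nn_integral_likelihood_ratio:
  assumes "set_pmf p \<subseteq> set_pmf m"
  shows "(\<integral>\<^sup>+x. ennreal (likelihood_ratio p m x) * f x \<partial>measure_pmf m) = (\<integral>\<^sup>+x. f x \<partial>measure_pmf p)"
  by (simp add: nn_integral_measure_pmf mult.assoc[symmetric] ennreal_mult[symmetric] pmf_times_likelihood_ratio[OF assms])

lemma bhattacharyya_likelihood_ratio:
  assumes "set_pmf p \<subseteq> set_pmf m" "set_pmf q \<subseteq> set_pmf m"
  shows "ennreal (bhattacharyya p q) =
    (\<integral>\<^sup>+x. ennreal (sqrt (likelihood_ratio p m x * likelihood_ratio q m x)) \<partial>measure_pmf m)"
proof -
  have "pmf m x * sqrt (likelihood_ratio p m x * likelihood_ratio q m x) = sqrt (pmf p x * pmf q x)" for x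
  proof -
    have "sqrt (pmf p x * pmf q x) = sqrt ((pmf m x * likelihood_ratio p m x) * (pmf m x * likelihood_ratio q m x))"
      unfolding assms[THEN pmf_times_likelihood_ratio] ..
    also have "\<dots> = sqrt ((pmf m x)\<^sup>2 * (likelihood_ratio p m x * likelihood_ratio q m x))"
      by (simp add: power2_eq_square ac_simps)
    finally show ?thesis by (simp add: real_sqrt_mult)
  qed
  then show ?thesis
    by (simp add: ennreal_bhattacharyya nn_integral_measure_pmf ennreal_mult[symmetric])
qed

lemma obtain_dominating_pmf:
  obtains m where "set_pmf p \<subseteq> set_pmf m" "set_pmf q \<subseteq> set_pmf m"
proof
  let ?m = "bind_pmf (bernoulli_pmf (1/2)) (\<lambda>b. if b then p else q)"
  show "set_pmf p \<subseteq> set_pmf ?m" "set_pmf q \<subseteq> set_pmf ?m"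
    by (auto split: if_splits)
qed

lemma bhattacharyya_map_inj:
  assumes "inj f"
  shows "bhattacharyya (map_pmf f p) (map_pmf f q) = bhattacharyya p q"
proof -
  obtain m where m: "set_pmf p \<subseteq> set_pmf m" "set_pmf q \<subseteq> set_pmf m"
    by (rule obtain_dominating_pmf)
  have "likelihood_ratio (map_pmf f r) (map_pmf f m) (f x) = likelihood_ratio r m x" for r x
    using assms by (simp add: likelihood_ratio_def pmf_map_inj')
  moreover have sub: "set_pmf (map_pmf f p) \<subseteq> set_pmf (map_pmf f m)" "set_pmf (map_pmf f q) \<subseteq> set_pmf (map_pmf f m)"
    using m by auto
  ultimately have "ennreal (bhattacharyya (map_pmf f p) (map_pmf f q)) = ennreal (bhattacharyya p q)"
    unfolding bhattacharyya_likelihood_ratio[OF sub] bhattacharyya_likelihood_ratio[OF m] by simp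
  then show ?thesis by simp
qed

lemma prod_list_map_times:
  "prod_list (map f xs) * prod_list (map g xs) = prod_list (map (\<lambda>x. f x * g x) xs)"
  for f :: "'a \<Rightarrow> 'b :: comm_monoid_mult"
  by (induction xs) (auto simp: ac_simps)

lemma sqrt_prod_list: "sqrt (prod_list (map f xs)) = prod_list (map (\<lambda>x. sqrt (f x)) xs)"
  by (induction xs) (auto simp: real_sqrt_mult)

lemma ennreal_prod_list:
  assumes "\<And>x. 0 \<le> f x"
  shows "ennreal (prod_list (map f xs)) = prod_list (map (\<lambda>x. ennreal (f x)) xs)"
proof (induction xs)
  case (Cons x xs)
  have "0 \<le> prod_list (map f xs)"
    using assms by (induction xs) auto
  with Cons show ?case using assms by (simp add: ennreal_mult)
qed simp

text \<open>The likelihood ratio of a list is the product of the ratios of its entries. Lists of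
  length \<open>k\<close> thus contribute \<open>z ^ k\<close> with
  \<open>z = bhattacharyya p q\<close>, and the Poisson generating function sums these
  powers.\<close>

lemma bhattacharyya_compound_poisson:
  assumes "0 < d"
  shows "bhattacharyya (compound_poisson d p) (compound_poisson d q) = exp (- d * (1 - bhattacharyya p q))"
proof -
  obtain m where m: "set_pmf p \<subseteq> set_pmf m" "set_pmf q \<subseteq> set_pmf m"
    by (rule obtain_dominating_pmf)
  \<comment> \<open>The Poisson weight of the length is common to both laws and cancels.\<close>
  have lr: "likelihood_ratio (compound_poisson d r) (compound_poisson d m) xs =
      prod_list (map (likelihood_ratio r m) xs)" for r xs
  proof -
    have "prod_list (map (pmf r) xs) / prod_list (map (pmf m) xs) = prod_list (map (likelihood_ratio r m) xs)"
      by (induction xs) (auto simp: likelihood_ratio_def times_divide_times_eq[symmetric])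
    moreover have "pmf (poisson_pmf d) (length xs) \<noteq> 0"
      using assms by simp
    ultimately show ?thesis
      using assms unfolding likelihood_ratio_def pmf_compound_poisson[OF assms] by simp
  qed
  have sub: "set_pmf (compound_poisson d r) \<subseteq> set_pmf (compound_poisson d m)" if "set_pmf r \<subseteq> set_pmf m" for r
    using that by (fastforce simp: compound_poisson_def set_replicate_pmf lists_eq_set)
  let ?g = "\<lambda>x. sqrt (likelihood_ratio p m x * likelihood_ratio q m x)"
  have "ennreal (bhattacharyya (compound_poisson d p) (compound_poisson d q)) =
      (\<integral>\<^sup>+xs. prod_list (map (\<lambda>x. ennreal (?g x)) xs) \<partial>measure_pmf (compound_poisson d m))"
    unfolding bhattacharyya_likelihood_ratio[OF sub[OF m(1)] sub[OF m(2)]]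
    by (simp add: lr prod_list_map_times sqrt_prod_list ennreal_prod_list)
  also have "\<dots> = (\<integral>\<^sup>+k. ennreal (bhattacharyya p q) ^ k \<partial>measure_pmf (poisson_pmf d))"
    by (simp add: compound_poisson_def nn_integral_replicate_pmf_prod bhattacharyya_likelihood_ratio[OF m])
  also have "\<dots> = ennreal (exp (- d * (1 - bhattacharyya p q)))"
    using assms by (simp add: ennreal_power nn_integral_poisson_pmf_power)
  finally show ?thesis by simp
qed

section \<open>Passing laws through a kernel\<close>

text \<open>Joint law of input and output; on this space the likelihood ratios before and after the
  kernel can be compared pointwise.\<close>

definition with_kernel :: "'a pmf \<Rightarrow> ('a \<Rightarrow> 'b pmf) \<Rightarrow> ('a \<times> 'b) pmf" where
  "with_kernel m K = bind_pmf m (\<lambda>s. map_pmf (Pair s) (K s))"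

lemma map_snd_with_kernel: "map_pmf snd (with_kernel m K) = bind_pmf m K"
  by (simp add: with_kernel_def map_bind_pmf map_pmf_comp o_def)

lemma map_fst_with_kernel: "map_pmf fst (with_kernel m K) = m"
  by (simp add: with_kernel_def map_bind_pmf map_pmf_comp bind_return_pmf')

lemma nn_integral_with_kernel:
  "(\<integral>\<^sup>+z. f z \<partial>measure_pmf (with_kernel m K)) = (\<integral>\<^sup>+s. \<integral>\<^sup>+t. f (s, t) \<partial>measure_pmf (K s) \<partial>measure_pmf m)"
  by (simp add: with_kernel_def)

lemma nn_integral_with_kernel_fst:
  "(\<integral>\<^sup>+z. f (fst z) \<partial>measure_pmf (with_kernel m K)) = (\<integral>\<^sup>+s. f s \<partial>measure_pmf m)"
  by (simp add: nn_integral_with_kernel)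

lemma nn_integral_with_kernel_snd:
  "(\<integral>\<^sup>+z. f (snd z) \<partial>measure_pmf (with_kernel m K)) = (\<integral>\<^sup>+t. f t \<partial>measure_pmf (bind_pmf m K))"
  by (simp add: nn_integral_with_kernel)

text \<open>The ratio at the output is the conditional expectation, given the output, of the ratio
  at the input. A change of measure turns both sides into the integral of \<open>g\<close> under
  \<open>bind_pmf p K\<close>.\<close>

lemma nn_integral_likelihood_ratio_tower:
  assumes "set_pmf p \<subseteq> set_pmf m"
  shows "(\<integral>\<^sup>+z. ennreal (likelihood_ratio p m (fst z)) * g (snd z) \<partial>measure_pmf (with_kernel m K)) =
    (\<integral>\<^sup>+z. ennreal (likelihood_ratio (bind_pmf p K) (bind_pmf m K) (snd z)) * g (snd z) \<partial>measure_pmf (with_kernel m K))"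
proof -
  have "set_pmf (bind_pmf p K) \<subseteq> set_pmf (bind_pmf m K)"
    using assms by auto
  note * = nn_integral_likelihood_ratio[OF assms] nn_integral_likelihood_ratio[OF this]
  show ?thesis
    unfolding nn_integral_with_kernel_snd[where f = "\<lambda>t. ennreal (likelihood_ratio (bind_pmf p K) (bind_pmf m K) t) * g t"] *
    by (simp add: nn_integral_with_kernel nn_integral_cmult * del: nn_integral_bind_pmf)
      simp
qed

text \<open>
  The defect of \<open>(u, v) \<mapsto> sqrt (u * v)\<close> from its tangent at \<open>(u', v')\<close>, i.e. its Bregman divergence up to sign.
\<close>

definition sqrt_bregman :: "real \<Rightarrow> real \<Rightarrow> real \<Rightarrow> real \<Rightarrow> real" where
  "sqrt_bregman u v u' v' = sqrt (u' * v') * (sqrt (u / u') - sqrt (v / v'))\<^sup>2 / 2"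

lemma sqrt_bregman_nonneg: "0 \<le> u' \<Longrightarrow> 0 \<le> v' \<Longrightarrow> 0 \<le> sqrt_bregman u v u' v'"
  by (simp add: sqrt_bregman_def)

text \<open>The geometric mean is homogeneous of degree one, so its tangent plane at
  \<open>(u', v')\<close> passes through the origin and the left side has no constant term. The
  implications on zeros express absolute continuity.\<close>

lemma sqrt_bregman_tangent:
  assumes "0 \<le> u" "0 \<le> v" "0 \<le> u'" "0 \<le> v'" "u' = 0 \<Longrightarrow> u = 0" "v' = 0 \<Longrightarrow> v = 0"
  shows "u * (sqrt (v' / u') / 2) + v * (sqrt (u' / v') / 2) = sqrt (u * v) + sqrt_bregman u v u' v'"
proof (cases "u' = 0 \<or> v' = 0")
  \<comment> \<open>Division by zero returns 0, so every term vanishes on the boundary.\<close>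
  case True
  then show ?thesis using assms by (auto simp: sqrt_bregman_def)
next
  case False
  define a b a' b' where ab: "a = sqrt u" "b = sqrt v" "a' = sqrt u'" "b' = sqrt v'"
  have sq: "u = a\<^sup>2" "v = b\<^sup>2" "u' = a'\<^sup>2" "v' = b'\<^sup>2" and nn: "0 \<le> a" "0 \<le> b" "0 < a'" "0 < b'"
    using assms False by (auto simp: ab)
  show ?thesis
    unfolding sqrt_bregman_def sq real_sqrt_mult real_sqrt_divide using nn
    by (simp add: field_simps power2_eq_square)
qed

text \<open>\<open>sqrt_bregman_tangent\<close> is integrated: in each linear term the tower
  property replaces the input ratio by the output ratio, which makes the term half of the output
  coefficient. The remainder is the mean Bregman term.\<close>

lemma bhattacharyya_kernel:
  fixes K :: "'a \<Rightarrow> 'b pmf"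
  assumes p: "set_pmf p \<subseteq> set_pmf m" and q: "set_pmf q \<subseteq> set_pmf m"
  defines "m' \<equiv> bind_pmf m K"
  shows "ennreal (bhattacharyya (bind_pmf p K) (bind_pmf q K)) = ennreal (bhattacharyya p q) +
    (\<integral>\<^sup>+z. ennreal (sqrt_bregman (likelihood_ratio p m (fst z)) (likelihood_ratio q m (fst z))
      (likelihood_ratio (bind_pmf p K) m' (snd z)) (likelihood_ratio (bind_pmf q K) m' (snd z))) \<partial>measure_pmf (with_kernel m K))"
proof -
  let ?J = "measure_pmf (with_kernel m K)"
  let ?u = "\<lambda>z. likelihood_ratio p m (fst z)" and ?v = "\<lambda>z. likelihood_ratio q m (fst z)"
  let ?u' = "\<lambda>z. likelihood_ratio (bind_pmf p K) m' (snd z)" and ?v' = "\<lambda>z. likelihood_ratio (bind_pmf q K) m' (snd z)"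
  have p': "set_pmf (bind_pmf p K) \<subseteq> set_pmf m'" and q': "set_pmf (bind_pmf q K) \<subseteq> set_pmf m'"
    using p q by (auto simp: m'_def)
  \<comment> \<open>In a pair of positive probability the output is reachable from the input, so a
    zero ratio at the output forces one at the input.\<close>
  have zero: "likelihood_ratio (bind_pmf r K) m' (snd z) = 0 \<Longrightarrow> likelihood_ratio r m (fst z) = 0" if "set_pmf r \<subseteq> set_pmf m" "z \<in> set_pmf (with_kernel m K)" for r z
    using that by (auto simp: m'_def likelihood_ratio_def with_kernel_def pmf_eq_0_set_pmf)
  \<comment> \<open>One linear term of the tangent plane, used for both orders of \<open>p\<close>
    and \<open>q\<close>.\<close>
  have half: "(\<integral>\<^sup>+z. ennreal (likelihood_ratio a m (fst z) * (sqrt (likelihood_ratio (bind_pmf b K) m' (snd z) / likelihood_ratio (bind_pmf a K) m' (snd z)) / 2)) \<partial>?J) =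
      ennreal (bhattacharyya (bind_pmf a K) (bind_pmf b K) / 2)"
    if a: "set_pmf a \<subseteq> set_pmf m" and b: "set_pmf b \<subseteq> set_pmf m" for a b
  proof -
    have ab': "set_pmf (bind_pmf a K) \<subseteq> set_pmf (bind_pmf m K)" "set_pmf (bind_pmf b K) \<subseteq> set_pmf (bind_pmf m K)"
      using a b by auto
    have pt: "x * (sqrt (y / x) / 2) = sqrt (x * y) * (1 / 2)" if "0 \<le> x" for x y :: real
      using that by (cases "x = 0") (simp_all add: real_sqrt_divide real_sqrt_mult real_div_sqrt field_simps)
    have ennreal_half: "ennreal (x * (1 / 2)) = ennreal x * ennreal (1 / 2)" for x
      by (rule ennreal_mult'') simp
    have "(\<integral>\<^sup>+z. ennreal (likelihood_ratio a m (fst z) * (sqrt (likelihood_ratio (bind_pmf b K) m' (snd z) / likelihood_ratio (bind_pmf a K) m' (snd z)) / 2)) \<partial>?J) =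
      (\<integral>\<^sup>+z. ennreal (likelihood_ratio (bind_pmf a K) m' (snd z) * (sqrt (likelihood_ratio (bind_pmf b K) m' (snd z) / likelihood_ratio (bind_pmf a K) m' (snd z)) / 2)) \<partial>?J)"
      using nn_integral_likelihood_ratio_tower[OF a, where K = K and g = "\<lambda>t. ennreal (sqrt (likelihood_ratio (bind_pmf b K) m' t / likelihood_ratio (bind_pmf a K) m' t) / 2)"]
      by (simp add: m'_def ennreal_mult del: times_divide_eq_right)
    also have "\<dots> = (\<integral>\<^sup>+t. ennreal (sqrt (likelihood_ratio (bind_pmf a K) m' t * likelihood_ratio (bind_pmf b K) m' t)) * ennreal (1/2) \<partial>measure_pmf (bind_pmf m K))"
      unfolding nn_integral_with_kernel_snd[symmetric]
      by (simp only: m'_def pt[OF likelihood_ratio_nonneg] ennreal_half)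
    also have "\<dots> = ennreal (bhattacharyya (bind_pmf a K) (bind_pmf b K) / 2)"
      using bhattacharyya_likelihood_ratio[OF ab'] ennreal_mult[of "bhattacharyya (bind_pmf a K) (bind_pmf b K)" "1/2"]
      by (simp add: nn_integral_multc m'_def del: nn_integral_bind_pmf)
    finally show ?thesis .
  qed
  have "ennreal (bhattacharyya (bind_pmf p K) (bind_pmf q K)) =
      ennreal (bhattacharyya (bind_pmf p K) (bind_pmf q K) / 2) + ennreal (bhattacharyya (bind_pmf q K) (bind_pmf p K) / 2)"
    by (simp add: ennreal_plus[symmetric] bhattacharyya_def mult.commute del: ennreal_plus)
  also have "\<dots> = (\<integral>\<^sup>+z. ennreal (?u z * (sqrt (?v' z / ?u' z) / 2) + ?v z * (sqrt (?u' z / ?v' z) / 2)) \<partial>?J)"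
    by (simp add: half[OF p q, symmetric] half[OF q p, symmetric] nn_integral_add[symmetric])
  also have "\<dots> = (\<integral>\<^sup>+z. ennreal (sqrt (?u z * ?v z)) + ennreal (sqrt_bregman (?u z) (?v z) (?u' z) (?v' z)) \<partial>?J)"
  proof (intro nn_integral_cong_AE AE_pmfI)
    fix z assume z: "z \<in> set_pmf (with_kernel m K)"
    show "ennreal (?u z * (sqrt (?v' z / ?u' z) / 2) + ?v z * (sqrt (?u' z / ?v' z) / 2)) =
        ennreal (sqrt (?u z * ?v z)) + ennreal (sqrt_bregman (?u z) (?v z) (?u' z) (?v' z))"
      by (subst sqrt_bregman_tangent) (use zero[OF p z] zero[OF q z] in \<open>auto simp: sqrt_bregman_nonneg\<close>)
  qed
  also have "\<dots> = ennreal (bhattacharyya p q) + (\<integral>\<^sup>+z. ennreal (sqrt_bregman (?u z) (?v z) (?u' z) (?v' z)) \<partial>?J)"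
    using bhattacharyya_likelihood_ratio[OF p q]
      nn_integral_with_kernel_fst[where m = m and K = K
        and f = "\<lambda>s. ennreal (sqrt (likelihood_ratio p m s * likelihood_ratio q m s))"]
    by (simp add: nn_integral_add)
  finally show ?thesis .
qed

lemma bhattacharyya_kernel_mono:
  "bhattacharyya p q \<le> bhattacharyya (bind_pmf p K) (bind_pmf q K)"
proof -
  obtain m where "set_pmf p \<subseteq> set_pmf m" "set_pmf q \<subseteq> set_pmf m"
    by (rule obtain_dominating_pmf)
  from bhattacharyya_kernel[OF this, of K]
  have "ennreal (bhattacharyya p q) \<le> ennreal (bhattacharyya (bind_pmf p K) (bind_pmf q K))"
    by simp
  then show ?thesis by (simp add: ennreal_le_iff)
qed

text \<open>A form of Chebyshev's inequality: \<open>\<bar>a - b\<bar>\<close> is at most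
  \<open>\<bar>f x - a\<bar> + \<bar>f x - b\<bar>\<close>, and the overlap weighted by either
  summand is at most \<open>sqrt V\<close> by Cauchy-Schwarz, here in its weighted mean
  form.\<close>

lemma bhattacharyya_le_deviation:
  fixes f :: "'a \<Rightarrow> real"
  assumes V: "0 < V"
    and p: "(\<integral>\<^sup>+x. ennreal ((f x - a)\<^sup>2) \<partial>measure_pmf p) \<le> ennreal V"
    and q: "(\<integral>\<^sup>+x. ennreal ((f x - b)\<^sup>2) \<partial>measure_pmf q) \<le> ennreal V"
  shows "bhattacharyya p q * \<bar>a - b\<bar> \<le> 2 * sqrt V"
proof -
  define c where "c = sqrt V"
  have c: "0 < c" "c\<^sup>2 = V" using V by (auto simp: c_def)
  \<comment> \<open>The weight \<open>c = sqrt V\<close> balances the two summands: each integrates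
    to at most \<open>c / 2\<close>.\<close>
  have am_gm: "sqrt (x * y) * z \<le> x * (z\<^sup>2 / (2 * c)) + y * (c / 2)" if "0 \<le> x" "0 \<le> y" for x y z
  proof -
    have "0 \<le> (sqrt x * z - c * sqrt y)\<^sup>2 / (2 * c)"
      using c by simp
    also have "\<dots> = x * (z\<^sup>2 / (2 * c)) + y * (c / 2) - sqrt (x * y) * z"
      using that c by (simp add: real_sqrt_mult power2_diff power_mult_distrib field_simps) (simp add: power2_eq_square)
    finally show ?thesis by simp
  qed
  have dev: "(\<integral>\<^sup>+x. ennreal (pmf r x) * ennreal ((f x - e)\<^sup>2 / (2 * c)) \<partial>count_space UNIV) \<le> ennreal (c / 2)"
    if "(\<integral>\<^sup>+x. ennreal ((f x - e)\<^sup>2) \<partial>measure_pmf r) \<le> ennreal V" for r e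
  proof -
    have "(\<integral>\<^sup>+x. ennreal (pmf r x) * ennreal ((f x - e)\<^sup>2 / (2 * c)) \<partial>count_space UNIV) =
        (\<integral>\<^sup>+x. ennreal ((f x - e)\<^sup>2) * ennreal (1 / (2 * c)) \<partial>measure_pmf r)"
      unfolding nn_integral_measure_pmf using c by (simp add: ennreal_mult[symmetric])
    also have "\<dots> \<le> ennreal V * ennreal (1 / (2 * c))"
      using that by (simp add: nn_integral_multc mult_right_mono)
    also have "\<dots> = ennreal (c / 2)"
      using c V by (simp add: ennreal_mult[symmetric] power2_eq_square flip: c(2))
    finally show ?thesis .
  qed
  have mass: "(\<integral>\<^sup>+x. ennreal (pmf r x) * ennreal (c / 2) \<partial>count_space UNIV) = ennreal (c / 2)" for r :: "'a pmf"
    using nn_integral_measure_pmf[of r "\<lambda>_. ennreal (c / 2)"] by simp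
  let ?A = "\<lambda>r e x. ennreal (pmf r x) * ennreal ((f x - e)\<^sup>2 / (2 * c))" and ?B = "\<lambda>r x. ennreal (pmf r x) * ennreal (c / 2)"
  have "ennreal (bhattacharyya p q * \<bar>a - b\<bar>) =
      (\<integral>\<^sup>+x. ennreal (sqrt (pmf p x * pmf q x) * \<bar>a - b\<bar>) \<partial>count_space UNIV)"
    by (simp add: ennreal_mult ennreal_bhattacharyya nn_integral_multc)
  also have "\<dots> \<le> (\<integral>\<^sup>+x. (?A p a x + ?B q x) + (?A q b x + ?B p x) \<partial>count_space UNIV)"
  proof (intro nn_integral_mono)
    fix x
    have "sqrt (pmf p x * pmf q x) * \<bar>a - b\<bar> \<le> sqrt (pmf p x * pmf q x) * (\<bar>f x - a\<bar> + \<bar>f x - b\<bar>)"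
      by (intro mult_left_mono) auto
    also have "\<dots> \<le> (pmf p x * ((f x - a)\<^sup>2 / (2 * c)) + pmf q x * (c / 2)) + (pmf q x * ((f x - b)\<^sup>2 / (2 * c)) + pmf p x * (c / 2))"
      using am_gm[of "pmf p x" "pmf q x" "\<bar>f x - a\<bar>"] am_gm[of "pmf q x" "pmf p x" "\<bar>f x - b\<bar>"]
      by (simp add: distrib_left mult.commute)
    finally show "ennreal (sqrt (pmf p x * pmf q x) * \<bar>a - b\<bar>) \<le> (?A p a x + ?B q x) + (?A q b x + ?B p x)"
      using c by (simp add: ennreal_mult[symmetric] ennreal_plus[symmetric] ennreal_le_iff del: ennreal_plus)
  qed
  also have "\<dots> = ((\<integral>\<^sup>+x. ?A p a x \<partial>count_space UNIV) + ennreal (c / 2)) + ((\<integral>\<^sup>+x. ?A q b x \<partial>count_space UNIV) + ennreal (c / 2))"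
    by (simp add: nn_integral_add mass)
  also have "\<dots> \<le> (ennreal (c / 2) + ennreal (c / 2)) + (ennreal (c / 2) + ennreal (c / 2))"
    by (intro add_mono dev p q order_refl)
  also have "\<dots> = ennreal (2 * c)"
    using c by (simp add: ennreal_plus[symmetric] del: ennreal_plus)
  finally show ?thesis using c by (simp add: c_def ennreal_le_iff)
qed

section \<open>Posteriors of a channel\<close>

lemma pmf_bind_finite:
  fixes p :: "'a :: finite pmf"
  shows "pmf (bind_pmf p W) s = (\<Sum>i\<in>UNIV. pmf p i * pmf (W i) s)"
  unfolding pmf_bind by (subst integral_measure_pmf_real[where A = UNIV]) (auto simp: mult.commute)

lemma has_bochner_integral_likelihood_ratio:
  assumes "set_pmf p \<subseteq> set_pmf m"
  shows "has_bochner_integral (measure_pmf m) (likelihood_ratio p m) 1"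
  using nn_integral_likelihood_ratio[OF assms, of "\<lambda>_. 1"]
  by (intro has_bochner_integral_nn_integral) auto

lemma has_bochner_integral_bhattacharyya:
  assumes "set_pmf p \<subseteq> set_pmf m" "set_pmf q \<subseteq> set_pmf m"
  shows "has_bochner_integral (measure_pmf m)
    (\<lambda>x. sqrt (likelihood_ratio p m x * likelihood_ratio q m x)) (bhattacharyya p q)"
  using bhattacharyya_likelihood_ratio[OF assms]
  by (intro has_bochner_integral_nn_integral) auto

section \<open>Two-sided bounds for the Bregman term\<close>

text \<open>The right side is twice the variance of \<open>r\<close> under the weights
  \<open>x\<close>.\<close>

lemma sum_weighted_square_diff:
  fixes x r :: "'q :: finite \<Rightarrow> real"
  assumes "(\<Sum>k\<in>UNIV. x k) = 1"
  shows "(\<Sum>k\<in>UNIV. \<Sum>l\<in>UNIV. x k * x l * (r k - r l)\<^sup>2) = 2 * ((\<Sum>k\<in>UNIV. x k * (r k)\<^sup>2) - (\<Sum>k\<in>UNIV. x k * r k)\<^sup>2)"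
proof -
  have "(\<Sum>k\<in>UNIV. \<Sum>l\<in>UNIV. x k * x l * (r k - r l)\<^sup>2) =
      (\<Sum>k\<in>UNIV. \<Sum>l\<in>UNIV. (x k * (r k)\<^sup>2) * x l + x k * (x l * (r l)\<^sup>2) - 2 * ((x k * r k) * (x l * r l)))"
    by (intro sum.cong) (auto simp: power2_eq_square algebra_simps)
  also have "\<dots> = 2 * ((\<Sum>k\<in>UNIV. x k * (r k)\<^sup>2) - (\<Sum>k\<in>UNIV. x k * r k)\<^sup>2)"
    (is "_ = 2 * (?S2 - ?S1\<^sup>2)")
  proof -
    have "(\<Sum>k\<in>UNIV. \<Sum>l\<in>UNIV. (x k * (r k)\<^sup>2) * x l + x k * (x l * (r l)\<^sup>2) - 2 * ((x k * r k) * (x l * r l))) =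
        ?S2 * (\<Sum>k\<in>UNIV. x k) + (\<Sum>k\<in>UNIV. x k) * ?S2 - 2 * (?S1 * ?S1)"
      unfolding sum.distrib sum_subtractf sum_product by (simp only: sum_distrib_left)
    then show ?thesis using assms by (simp add: power2_eq_square)
  qed
  finally show ?thesis .
qed

text \<open>\<open>x = p * u\<close> and \<open>y = p * v\<close> are probability vectors with
  Bhattacharyya coefficient \<open>b\<close>. The variance of \<open>r = sqrt (x / y)\<close> under
  \<open>y\<close> is \<open>1 - b\<^sup>2\<close>; written over pairs it is at most the Bregman
  sum, while \<open>8 * (1 - b)\<close> bounds the square distance.\<close>

lemma sum_sqrt_bregman_ge:
  fixes p u v :: "'q :: finite \<Rightarrow> real"
  assumes p: "\<And>k. 0 < p k" "\<And>k. p k \<le> 1"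
    and nonneg: "\<And>k. 0 \<le> u k" "\<And>k. 0 \<le> v k"
    and sum: "(\<Sum>k\<in>UNIV. p k * u k) = 1" "(\<Sum>k\<in>UNIV. p k * v k) = 1"
    and zero: "\<And>k. v k = 0 \<Longrightarrow> u k = 0"
  shows "(\<Sum>k\<in>UNIV. (p k * u k - p k * v k)\<^sup>2) \<le> 8 * (\<Sum>k\<in>UNIV. \<Sum>l\<in>UNIV. sqrt_bregman (u k) (u l) (v k) (v l))"
proof -
  define x y r where "x k = p k * u k" and "y k = p k * v k" and "r k = sqrt (u k / v k)" for k
  have x: "0 \<le> x k" and y: "0 \<le> y k" for k
    using p[of k] nonneg[of k] by (auto simp: x_def y_def)
  have le1: "x k \<le> 1" "y k \<le> 1" for k
    using sum member_le_sum[of k UNIV x] member_le_sum[of k UNIV y] x y by (auto simp: x_def y_def)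
  have sx: "(\<Sum>k\<in>UNIV. x k) = 1" and sy: "(\<Sum>k\<in>UNIV. y k) = 1"
    using sum by (auto simp: x_def y_def)
  have yr2: "y k * (r k)\<^sup>2 = x k" for k
    using nonneg[of k] zero[of k] by (auto simp: x_def y_def r_def)
  have yr: "y k * r k = sqrt (x k * y k)" for k
  proof (rule real_sqrt_unique[symmetric])
    show "(y k * r k)\<^sup>2 = x k * y k"
      using yr2[of k] by (simp add: power2_eq_square algebra_simps)
    show "0 \<le> y k * r k"
      using y nonneg[of k] by (simp add: r_def)
  qed
  define b where "b = (\<Sum>k\<in>UNIV. sqrt (x k * y k))"
  \<comment> \<open>The factor 4 bounds \<open>(sqrt (x k) + sqrt (y k))\<^sup>2\<close>.\<close>
  have point: "(x k - y k)\<^sup>2 \<le> 4 * (x k + y k - 2 * sqrt (x k * y k))" for k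
  proof -
    have "x k - y k = (sqrt (x k) - sqrt (y k)) * (sqrt (x k) + sqrt (y k))"
      using x y by (simp add: algebra_simps)
    then have "(x k - y k)\<^sup>2 = (sqrt (x k) - sqrt (y k))\<^sup>2 * (sqrt (x k) + sqrt (y k))\<^sup>2"
      by (simp add: power_mult_distrib)
    also have "\<dots> \<le> (sqrt (x k) - sqrt (y k))\<^sup>2 * 2\<^sup>2"
    proof -
      have "sqrt (x k) \<le> 1" "sqrt (y k) \<le> 1"
        using le1 by auto
      then have "sqrt (x k) + sqrt (y k) \<le> 2" by linarith
      then show ?thesis
        using x y by (intro mult_left_mono power_mono) auto
    qed
    also have "(sqrt (x k) - sqrt (y k))\<^sup>2 = x k + y k - 2 * sqrt (x k * y k)"
      using x y by (simp add: power2_diff real_sqrt_mult)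
    finally show ?thesis by (simp add: mult.commute)
  qed
  have "(\<Sum>k\<in>UNIV. (x k - y k)\<^sup>2) \<le> (\<Sum>k\<in>UNIV. 4 * (x k + y k - 2 * sqrt (x k * y k)))"
    by (intro sum_mono point)
  also have "\<dots> = 8 * (1 - b)"
    by (simp add: sum_distrib_left[symmetric] sum_subtractf sum.distrib sx sy b_def)
  finally have dist: "(\<Sum>k\<in>UNIV. (x k - y k)\<^sup>2) \<le> 8 * (1 - b)" .
  have "b \<ge> 0"
    unfolding b_def using x y by (intro sum_nonneg) auto
  have "0 \<le> (\<Sum>k\<in>UNIV. (x k - y k)\<^sup>2)"
    by (intro sum_nonneg) auto
  with dist have "b \<le> 1" by simp
  with \<open>b \<ge> 0\<close> have "b\<^sup>2 \<le> b"
    by (simp add: power2_eq_square mult_left_le)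
  have "2 * (1 - b\<^sup>2) = (\<Sum>k\<in>UNIV. \<Sum>l\<in>UNIV. y k * y l * (r k - r l)\<^sup>2)"
    unfolding sum_weighted_square_diff[OF sy] yr2 yr sx b_def ..
  also have "\<dots> \<le> (\<Sum>k\<in>UNIV. \<Sum>l\<in>UNIV. 2 * sqrt_bregman (u k) (u l) (v k) (v l))"
  proof (intro sum_mono)
    fix k l
    \<comment> \<open>Entries of \<open>y\<close> are at most 1, so a product of two is at most its
      square root; then the weights \<open>p\<close> are dropped.\<close>
    have yv: "y k \<le> v k" for k
      using p[of k] nonneg[of k] by (simp add: y_def mult_left_le_one_le)
    have "y k * y l \<le> sqrt (y k * y l)"
      using y[of k] y[of l] le1[of k] le1[of l]
      by (intro real_le_rsqrt) (auto simp: power2_eq_square mult_le_one intro!: mult_left_le)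
    also have "\<dots> \<le> sqrt (v k * v l)"
      using yv y by (intro real_sqrt_le_mono mult_mono nonneg)
    finally show "y k * y l * (r k - r l)\<^sup>2 \<le> 2 * sqrt_bregman (u k) (u l) (v k) (v l)"
      by (simp add: sqrt_bregman_def r_def mult_right_mono)
  qed
  finally have "1 - b\<^sup>2 \<le> (\<Sum>k\<in>UNIV. \<Sum>l\<in>UNIV. sqrt_bregman (u k) (u l) (v k) (v l))"
    by (simp add: sum_distrib_left[symmetric])
  with dist \<open>b\<^sup>2 \<le> b\<close> show ?thesis
    by (simp add: x_def y_def)
qed

text \<open>The term equals \<open>(A - B)\<^sup>2 / (2 * sqrt (u' * v'))\<close>, and
  \<open>A\<^sup>2 - B\<^sup>2 = u * v' - v * u'\<close> is of the order of the displacement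
  \<open>e\<close>; hence a quadratic bound away from 0.\<close>

lemma sqrt_bregman_le:
  assumes c: "0 < c" "c \<le> u" "c \<le> v" "c \<le> u'" "c \<le> v'" and b: "u' \<le> b" "v' \<le> b"
    and e: "\<bar>u - u'\<bar> \<le> e" "\<bar>v - v'\<bar> \<le> e"
  shows "sqrt_bregman u v u' v' \<le> (2 * b * e)\<^sup>2 / (8 * c ^ 3)"
proof -
  define A B where "A = sqrt (u * v')" and "B = sqrt (v * u')"
  have pos: "0 < u" "0 < v" "0 < u'" "0 < v'" using c by auto
  have sq: "x * y \<ge> c\<^sup>2" if "c \<le> x" "c \<le> y" for x y
    using that c by (simp add: power2_eq_square mult_mono)
  have sqrt_ge: "c \<le> sqrt (x * y)" if "c \<le> x" "c \<le> y" for x y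
    using sq[OF that] by (rule real_le_rsqrt)
  have AB: "c \<le> A" "c \<le> B" and uv: "c \<le> sqrt (u' * v')"
    using c by (auto simp: A_def B_def intro!: sqrt_ge)
  have diff: "(A - B) * (A + B) = u * v' - v * u'"
    using pos by (simp add: A_def B_def algebra_simps)
  have "sqrt (u / u') - sqrt (v / v') = (A - B) / sqrt (u' * v')"
    using pos by (simp add: A_def B_def real_sqrt_mult real_sqrt_divide field_simps)
  then have "sqrt_bregman u v u' v' = sqrt (u' * v') * ((A - B) / sqrt (u' * v'))\<^sup>2 / 2"
    unfolding sqrt_bregman_def by (simp only:)
  also have "\<dots> = (A - B)\<^sup>2 / (2 * sqrt (u' * v'))"
    using pos by (simp add: power_divide del: real_sqrt_pow2_iff real_sqrt_pow2)
      (simp add: power2_eq_square del: real_sqrt_mult_self)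
  also have "\<dots> \<le> (A - B)\<^sup>2 / (2 * c)"
    using uv c pos by (intro divide_left_mono) auto
  \<comment> \<open>A factor that is at least 1 turns \<open>A - B\<close> into
    \<open>(A - B) * (A + B)\<close>, which is free of square roots.\<close>
  also have "\<dots> \<le> (A - B)\<^sup>2 * ((A + B)\<^sup>2 / (4 * c\<^sup>2)) / (2 * c)"
  proof -
    have "(2 * c)\<^sup>2 \<le> (A + B)\<^sup>2"
      using AB c by (intro power_mono) auto
    then have "1 \<le> (A + B)\<^sup>2 / (4 * c\<^sup>2)"
      using c by (simp add: power_mult_distrib)
    from mult_left_mono[OF this, of "(A - B)\<^sup>2"] show ?thesis
      using c by (intro divide_right_mono) auto
  qed
  also have "\<dots> = (u * v' - v * u')\<^sup>2 / (8 * c ^ 3)"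
    unfolding diff[symmetric] by (simp add: power2_eq_square power3_eq_cube ac_simps)
  also have "\<dots> \<le> (2 * b * e)\<^sup>2 / (8 * c ^ 3)"
  proof -
    have "u * v' - v * u' = (u - u') * v' - (v - v') * u'"
      by (simp add: algebra_simps)
    also have "\<bar>\<dots>\<bar> \<le> \<bar>u - u'\<bar> * v' + \<bar>v - v'\<bar> * u'"
      using abs_triangle_ineq4[of "(u - u') * v'" "(v - v') * u'"] pos by (simp add: abs_mult)
    also have "\<dots> \<le> e * b + e * b"
      using e b pos by (intro add_mono mult_mono) auto
    finally have "\<bar>u * v' - v * u'\<bar> \<le> 2 * b * e" by (simp add: ac_simps)
    from power_mono[OF this, of 2] show ?thesis
      using c by (intro divide_right_mono) auto
  qed
  finally show ?thesis .
qed

section \<open>Bayes posteriors and the gap of a channel\<close>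

text \<open>Bayes' rule, with value 0 at observations of probability 0.\<close>

definition channel_posterior :: "'q pmf \<Rightarrow> ('q \<Rightarrow> 'a pmf) \<Rightarrow> 'q \<Rightarrow> 'a \<Rightarrow> real" where
  "channel_posterior \<pi> W i s = pmf \<pi> i * likelihood_ratio (W i) (bind_pmf \<pi> W) s"

text \<open>The diagonal contributes 0, since both coefficients are 1 there.\<close>

definition bhattacharyya_gap :: "('q :: finite \<Rightarrow> 'a pmf) \<Rightarrow> ('a \<Rightarrow> 'b pmf) \<Rightarrow> real" where
  "bhattacharyya_gap W K =
    (\<Sum>k\<in>UNIV. \<Sum>l\<in>UNIV. bhattacharyya (bind_pmf (W k) K) (bind_pmf (W l) K) - bhattacharyya (W k) (W l))"

lemma bhattacharyya_gap_nonneg: "0 \<le> bhattacharyya_gap W K"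
  unfolding bhattacharyya_gap_def by (intro sum_nonneg) (simp add: bhattacharyya_kernel_mono)

context
  fixes \<pi> :: "'q :: finite pmf"
  assumes full_support: "\<And>i. 0 < pmf \<pi> i"
begin

lemma set_pmf_channel: "set_pmf (W i) \<subseteq> set_pmf (bind_pmf \<pi> W)"
proof -
  have "i \<in> set_pmf \<pi>"
    using full_support[of i] by (simp add: set_pmf_iff)
  then show ?thesis by auto
qed

lemma set_pmf_mixture: "set_pmf (bind_pmf p W) \<subseteq> set_pmf (bind_pmf \<pi> W)"
  using set_pmf_channel[of W] by auto

lemma channel_posterior_nonneg [simp]: "0 \<le> channel_posterior \<pi> W i s"
  by (simp add: channel_posterior_def)

lemma sum_channel_posterior:
  assumes "s \<in> set_pmf (bind_pmf \<pi> W)"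
  shows "(\<Sum>i\<in>UNIV. channel_posterior \<pi> W i s) = 1"
proof -
  have "pmf (bind_pmf \<pi> W) s \<noteq> 0"
    using assms unfolding set_pmf_iff .
  then show ?thesis
    unfolding channel_posterior_def likelihood_ratio_def
    by (simp add: pmf_bind_finite sum_divide_distrib[symmetric])
qed

lemma channel_posterior_le_1: "channel_posterior \<pi> W i s \<le> 1"
proof (cases "s \<in> set_pmf (bind_pmf \<pi> W)")
  case True
  then show ?thesis
    using sum_channel_posterior[OF True] member_le_sum[of i UNIV "\<lambda>i. channel_posterior \<pi> W i s"] by simp
next
  case False
  then have "pmf (bind_pmf \<pi> W) s = 0" by (simp only: set_pmf_iff not_not)
  then show ?thesis by (simp add: channel_posterior_def likelihood_ratio_def)
qed

text \<open>Linearity in the vector of posteriors is the point: a difference of mixture ratios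
  becomes a linear functional of a difference of posteriors.\<close>

lemma likelihood_ratio_mixture:
  "likelihood_ratio (bind_pmf p W) (bind_pmf \<pi> W) s = (\<Sum>l\<in>UNIV. pmf p l / pmf \<pi> l * channel_posterior \<pi> W l s)"
proof -
  have "pmf p l / pmf \<pi> l * channel_posterior \<pi> W l s = pmf p l * pmf (W l) s / pmf (bind_pmf \<pi> W) s" for l
    using full_support[of l] by (simp add: channel_posterior_def likelihood_ratio_def)
  then show ?thesis
    by (simp add: likelihood_ratio_def pmf_bind_finite sum_divide_distrib)
qed

text \<open>\<open>sum_sqrt_bregman_ge\<close> is applied pointwise with weights
  \<open>\<pi>\<close>; its two vectors are the posteriors given the input and the output. By
  \<open>bhattacharyya_kernel\<close> each Bregman term integrates to the increase of one
  coefficient.\<close>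

lemma nn_integral_posterior_dist_le:
  fixes W :: "'q \<Rightarrow> 'a pmf" and K :: "'a \<Rightarrow> 'b pmf"
  shows "(\<integral>\<^sup>+z. ennreal (\<Sum>i\<in>UNIV. (channel_posterior \<pi> W i (fst z) - channel_posterior \<pi> (\<lambda>i. bind_pmf (W i) K) i (snd z))\<^sup>2)
    \<partial>measure_pmf (with_kernel (bind_pmf \<pi> W) K)) \<le> ennreal (8 * bhattacharyya_gap W K)"
proof -
  let ?m = "bind_pmf \<pi> W" and ?W' = "\<lambda>i. bind_pmf (W i) K"
  let ?J = "measure_pmf (with_kernel ?m K)"
  define u where "u k z = likelihood_ratio (W k) ?m (fst z)" for k and z :: "'a \<times> 'b"
  define v where "v k z = likelihood_ratio (?W' k) (bind_pmf ?m K) (snd z)" for k and z :: "'a \<times> 'b"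
  have m': "bind_pmf \<pi> ?W' = bind_pmf ?m K"
    by (simp add: bind_assoc_pmf)
  have uv: "channel_posterior \<pi> W i (fst z) = pmf \<pi> i * u i z" "channel_posterior \<pi> ?W' i (snd z) = pmf \<pi> i * v i z" for i z
    unfolding channel_posterior_def u_def v_def m' by auto
  have breg: "(\<integral>\<^sup>+z. ennreal (sqrt_bregman (u k z) (u l z) (v k z) (v l z)) \<partial>?J) =
      ennreal (bhattacharyya (?W' k) (?W' l) - bhattacharyya (W k) (W l))" for k l
    using bhattacharyya_kernel[OF set_pmf_channel[of W k] set_pmf_channel[of W l], of K]
    by (simp add: u_def v_def ennreal_minus ennreal_add_diff_cancel_left[symmetric] ennreal_minus[symmetric])
  have "(\<integral>\<^sup>+z. ennreal (\<Sum>i\<in>UNIV. (pmf \<pi> i * u i z - pmf \<pi> i * v i z)\<^sup>2) \<partial>?J) \<le>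
      (\<integral>\<^sup>+z. ennreal 8 * (\<Sum>k\<in>UNIV. \<Sum>l\<in>UNIV. ennreal (sqrt_bregman (u k z) (u l z) (v k z) (v l z))) \<partial>?J)"
  proof (intro nn_integral_mono_AE AE_pmfI)
    fix z assume z: "z \<in> set_pmf (with_kernel ?m K)"
    then have fst: "fst z \<in> set_pmf ?m" and snd: "snd z \<in> set_pmf (K (fst z))"
      by (auto simp: with_kernel_def)
    then have snd': "snd z \<in> set_pmf (bind_pmf \<pi> ?W')"
      unfolding m' by auto
    have nonneg: "0 \<le> u k z" "0 \<le> v k z" for k
      by (auto simp: u_def v_def)
    have zero: "u k z = 0" if "v k z = 0" for k
      using that snd snd' unfolding m' u_def v_def likelihood_ratio_def
      by (auto simp: pmf_eq_0_set_pmf)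
    have "(\<Sum>i\<in>UNIV. (pmf \<pi> i * u i z - pmf \<pi> i * v i z)\<^sup>2) \<le> 8 * (\<Sum>k\<in>UNIV. \<Sum>l\<in>UNIV. sqrt_bregman (u k z) (u l z) (v k z) (v l z))"
      using sum_channel_posterior[OF fst] sum_channel_posterior[OF snd'] unfolding uv
      by (intro sum_sqrt_bregman_ge full_support pmf_le_1 nonneg zero)
    also have "ennreal \<dots> = ennreal 8 * (\<Sum>k\<in>UNIV. \<Sum>l\<in>UNIV. ennreal (sqrt_bregman (u k z) (u l z) (v k z) (v l z)))"
      using nonneg by (simp add: ennreal_mult' sum_nonneg sqrt_bregman_nonneg sum_ennreal)
    finally show "ennreal (\<Sum>i\<in>UNIV. (pmf \<pi> i * u i z - pmf \<pi> i * v i z)\<^sup>2) \<le> \<dots>"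
      by (simp add: ennreal_leI)
  qed
  also have "\<dots> = ennreal 8 * (\<Sum>k\<in>UNIV. \<Sum>l\<in>UNIV. ennreal (bhattacharyya (?W' k) (?W' l) - bhattacharyya (W k) (W l)))"
    by (simp add: nn_integral_cmult nn_integral_sum breg)
  also have "\<dots> = ennreal (8 * bhattacharyya_gap W K)"
    by (simp add: bhattacharyya_gap_def ennreal_mult' sum_nonneg sum_ennreal bhattacharyya_kernel_mono)
  finally show ?thesis unfolding uv .
qed
end

lemma sum_abs_square_le:
  fixes h :: "'q :: finite \<Rightarrow> real"
  shows "(\<Sum>l\<in>UNIV. \<bar>h l\<bar>)\<^sup>2 \<le> real CARD('q) * (\<Sum>l\<in>UNIV. (h l)\<^sup>2)"
  using Cauchy_Schwarz_ineq_sum[of "\<lambda>_. 1" "\<lambda>l. \<bar>h l\<bar>" UNIV] by simp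

context
  fixes \<pi> :: "'q :: finite pmf" and a :: real
  assumes full_support: "\<And>i. 0 < pmf \<pi> i"
    and a: "0 < a" "\<And>i. a \<le> pmf \<pi> i"
begin

text \<open>The mixture ratios lie between \<open>c\<close> and \<open>1 / a\<close>, so
  \<open>sqrt_bregman_le\<close> applies. Their displacement is a functional of a difference of
  posteriors, a vector of sum 0, to which \<open>contr\<close> applies; the mean square distance of
  the posteriors is then bounded by the gap.\<close>

lemma bhattacharyya_mixture_gap_le:
  fixes W :: "'q \<Rightarrow> 'a pmf" and K :: "'a \<Rightarrow> 'b pmf"
  assumes c: "0 < c" "\<And>l. c \<le> pmf p l" "\<And>l. c \<le> pmf q l" and \<kappa>: "0 \<le> \<kappa>"
    and contr: "\<And>h. (\<Sum>l\<in>UNIV. h l) = 0 \<Longrightarrow> \<bar>\<Sum>l\<in>UNIV. pmf p l / pmf \<pi> l * h l\<bar> \<le> \<kappa> * (\<Sum>l\<in>UNIV. \<bar>h l\<bar>)"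
      "\<And>h. (\<Sum>l\<in>UNIV. h l) = 0 \<Longrightarrow> \<bar>\<Sum>l\<in>UNIV. pmf q l / pmf \<pi> l * h l\<bar> \<le> \<kappa> * (\<Sum>l\<in>UNIV. \<bar>h l\<bar>)"
  shows "bhattacharyya (bind_pmf (bind_pmf p W) K) (bind_pmf (bind_pmf q W) K) - bhattacharyya (bind_pmf p W) (bind_pmf q W)
    \<le> 4 * \<kappa>\<^sup>2 * real CARD('q) / (a\<^sup>2 * c ^ 3) * bhattacharyya_gap W K"
proof -
  let ?m = "bind_pmf \<pi> W" and ?W' = "\<lambda>i. bind_pmf (W i) K"
  let ?J = "measure_pmf (with_kernel ?m K)"
  \<comment> \<open>\<open>sqrt_bregman_le\<close> with upper bound \<open>1 / a\<close> gives all
    but \<open>CARD('q)\<close>, which comes from passing to a sum of squares. The factor 8 of the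
    posterior distance completes the constant.\<close>
  let ?C = "\<kappa>\<^sup>2 * real CARD('q) / (2 * a\<^sup>2 * c ^ 3)"
  define x where "x i z = channel_posterior \<pi> W i (fst z)" for i and z :: "'a \<times> 'b"
  define y where "y i z = channel_posterior \<pi> ?W' i (snd z)" for i and z :: "'a \<times> 'b"
  define u where "u r z = likelihood_ratio (bind_pmf r W) ?m (fst z)" for r and z :: "'a \<times> 'b"
  define v where "v r z = likelihood_ratio (bind_pmf (bind_pmf r W) K) (bind_pmf ?m K) (snd z)" for r and z :: "'a \<times> 'b"
  have m': "bind_pmf \<pi> ?W' = bind_pmf ?m K" and r': "bind_pmf r ?W' = bind_pmf (bind_pmf r W) K" for r
    by (simp_all add: bind_assoc_pmf)
  have u: "u r z = (\<Sum>l\<in>UNIV. pmf r l / pmf \<pi> l * x l z)" for r z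
    unfolding u_def x_def by (rule likelihood_ratio_mixture[OF full_support])
  have v: "v r z = (\<Sum>l\<in>UNIV. pmf r l / pmf \<pi> l * y l z)" for r z
    using likelihood_ratio_mixture[OF full_support, of r ?W' "snd z"] unfolding v_def y_def m' r' .
  have breg: "ennreal (bhattacharyya (bind_pmf (bind_pmf p W) K) (bind_pmf (bind_pmf q W) K) - bhattacharyya (bind_pmf p W) (bind_pmf q W)) =
      (\<integral>\<^sup>+z. ennreal (sqrt_bregman (u p z) (u q z) (v p z) (v q z)) \<partial>?J)"
    using bhattacharyya_kernel[OF set_pmf_mixture[OF full_support, of p W] set_pmf_mixture[OF full_support, of q W], of K]
    by (simp add: u_def v_def ennreal_minus ennreal_add_diff_cancel_left[symmetric] ennreal_minus[symmetric])
  also have "\<dots> \<le> (\<integral>\<^sup>+z. ennreal ?C * ennreal (\<Sum>i\<in>UNIV. (x i z - y i z)\<^sup>2) \<partial>?J)"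
  proof (intro nn_integral_mono_AE AE_pmfI)
    fix z assume z: "z \<in> set_pmf (with_kernel ?m K)"
    then have fst: "fst z \<in> set_pmf ?m" and snd: "snd z \<in> set_pmf (bind_pmf \<pi> ?W')"
      unfolding m' by (auto simp: with_kernel_def) blast+
    have sx: "(\<Sum>i\<in>UNIV. x i z) = 1" and sy: "(\<Sum>i\<in>UNIV. y i z) = 1"
      using sum_channel_posterior[OF full_support fst] sum_channel_posterior[OF full_support snd] by (auto simp: x_def y_def)
    have x0: "0 \<le> x i z" and y0: "0 \<le> y i z" for i
      by (auto simp: x_def y_def channel_posterior_nonneg[OF full_support])
    \<comment> \<open>A convex combination of the weights \<open>pmf r l / pmf \<pi> l\<close>,
      which are at least \<open>c\<close> because \<open>pmf \<pi> l \<le> 1\<close> and at most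
      \<open>1 / a\<close> because \<open>pmf r l \<le> 1\<close>.\<close>
    have ge: "c \<le> (\<Sum>l\<in>UNIV. pmf r l / pmf \<pi> l * w l)" and le: "(\<Sum>l\<in>UNIV. pmf r l / pmf \<pi> l * w l) \<le> 1 / a"
      if r: "\<And>l. c \<le> pmf r l" and w: "\<And>i. 0 \<le> w i" "(\<Sum>i\<in>UNIV. w i) = 1" for r w
    proof -
      have "c \<le> pmf r l / pmf \<pi> l" for l
        using r[of l] full_support[of l] pmf_le_1[of \<pi> l] c(1)
        by (simp add: pos_le_divide_eq) (metis mult_left_le order_trans less_imp_le)
      then have "(\<Sum>l\<in>UNIV. c * w l) \<le> (\<Sum>l\<in>UNIV. pmf r l / pmf \<pi> l * w l)"
        using w by (intro sum_mono mult_right_mono) auto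
      then show "c \<le> (\<Sum>l\<in>UNIV. pmf r l / pmf \<pi> l * w l)"
        using w by (simp add: sum_distrib_left[symmetric])
      have "pmf r l / pmf \<pi> l \<le> 1 / a" for l
        using a pmf_le_1[of r l] by (intro frac_le) auto
      then have "(\<Sum>l\<in>UNIV. pmf r l / pmf \<pi> l * w l) \<le> (\<Sum>l\<in>UNIV. 1 / a * w l)"
        using w by (intro sum_mono mult_right_mono) auto
      then show "(\<Sum>l\<in>UNIV. pmf r l / pmf \<pi> l * w l) \<le> 1 / a"
        using w by (simp only: sum_distrib_left[symmetric])
    qed
    let ?e = "\<kappa> * (\<Sum>l\<in>UNIV. \<bar>x l z - y l z\<bar>)"
    have diff: "u r z - v r z = (\<Sum>l\<in>UNIV. pmf r l / pmf \<pi> l * (x l z - y l z))" for r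
      unfolding u v by (simp add: sum_subtractf[symmetric] right_diff_distrib)
    have zero: "(\<Sum>l\<in>UNIV. x l z - y l z) = 0"
      using sx sy by (simp add: sum_subtractf)
    have "sqrt_bregman (u p z) (u q z) (v p z) (v q z) \<le> (2 * (1 / a) * ?e)\<^sup>2 / (8 * c ^ 3)"
    proof (rule sqrt_bregman_le[OF c(1)])
      show "\<bar>u p z - v p z\<bar> \<le> ?e" "\<bar>u q z - v q z\<bar> \<le> ?e"
        unfolding diff by (intro contr zero)+
    qed (unfold u v, (intro ge le c x0 y0 sx sy)+)
    also have "\<dots> = \<kappa>\<^sup>2 / (2 * a\<^sup>2 * c ^ 3) * (\<Sum>l\<in>UNIV. \<bar>x l z - y l z\<bar>)\<^sup>2"
      by (simp add: power_mult_distrib power_divide)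
    also have "\<dots> \<le> \<kappa>\<^sup>2 / (2 * a\<^sup>2 * c ^ 3) * (real CARD('q) * (\<Sum>l\<in>UNIV. (x l z - y l z)\<^sup>2))"
      using a c(1) by (intro mult_left_mono sum_abs_square_le) auto
    also have "\<dots> = ?C * (\<Sum>l\<in>UNIV. (x l z - y l z)\<^sup>2)"
      by simp
    finally show "ennreal (sqrt_bregman (u p z) (u q z) (v p z) (v q z)) \<le> ennreal ?C * ennreal (\<Sum>i\<in>UNIV. (x i z - y i z)\<^sup>2)"
      using a c(1) by (subst ennreal_mult[symmetric]) (auto intro!: ennreal_leI sum_nonneg)
  qed
  also have "\<dots> = ennreal ?C * (\<integral>\<^sup>+z. ennreal (\<Sum>i\<in>UNIV. (x i z - y i z)\<^sup>2) \<partial>?J)"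
    by (rule nn_integral_cmult) simp
  also have "\<dots> \<le> ennreal ?C * ennreal (8 * bhattacharyya_gap W K)"
    unfolding x_def y_def by (intro mult_left_mono nn_integral_posterior_dist_le[OF full_support]) auto
  also have "\<dots> = ennreal (?C * (8 * bhattacharyya_gap W K))"
    using a c(1) by (subst ennreal_mult) (auto simp: bhattacharyya_gap_nonneg)
  finally have "bhattacharyya (bind_pmf (bind_pmf p W) K) (bind_pmf (bind_pmf q W) K) - bhattacharyya (bind_pmf p W) (bind_pmf q W)
      \<le> ?C * (8 * bhattacharyya_gap W K)"
    using a c(1) by (subst (asm) ennreal_le_iff) (auto simp: bhattacharyya_gap_nonneg)
  then show ?thesis by (simp add: ac_simps)
qed

text \<open>\<open>u p - u q\<close> is the posterior mean of \<open>\<alpha>\<close>. If the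
  channel nearly determines the label, the posterior variance of \<open>\<alpha>\<close> is small,
  so the mean of \<open>(u p - u q)\<^sup>2\<close> is not much below that of
  \<open>\<alpha>\<^sup>2\<close>, which is at least \<open>s\<^sup>2\<close>. It is also at most
  \<open>8 / a\<close> times one minus the coefficient.\<close>

lemma bhattacharyya_mixture_le:
  fixes W :: "'q \<Rightarrow> 'a pmf"
  assumes \<kappa>: "\<And>l. \<bar>pmf p l - pmf q l\<bar> / pmf \<pi> l \<le> \<kappa>"
    and s: "0 \<le> s" "s \<le> (\<Sum>l\<in>UNIV. \<bar>pmf p l - pmf q l\<bar>)"
    and \<epsilon>: "\<And>k l. k \<noteq> l \<Longrightarrow> bhattacharyya (W k) (W l) \<le> \<epsilon>" and "0 \<le> \<epsilon>"
  shows "a / 8 * (s\<^sup>2 - 2 * \<kappa>\<^sup>2 * (real CARD('q))\<^sup>2 * \<epsilon>) \<le> 1 - bhattacharyya (bind_pmf p W) (bind_pmf q W)"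
proof -
  let ?m = "bind_pmf \<pi> W" and ?n = "real CARD('q)"
  define \<alpha> where "\<alpha> l = (pmf p l - pmf q l) / pmf \<pi> l" for l
  define x where "x l t = channel_posterior \<pi> W l t" for l t
  define u where "u r = likelihood_ratio (bind_pmf r W) ?m" for r
  define w where "w l = likelihood_ratio (W l) ?m" for l
  have u: "u r t = (\<Sum>l\<in>UNIV. pmf r l / pmf \<pi> l * x l t)" for r t
    unfolding u_def x_def by (rule likelihood_ratio_mixture[OF full_support])
  have x: "x l t = pmf \<pi> l * w l t" for l t
    by (simp add: x_def w_def channel_posterior_def)
  have x0: "0 \<le> x l t" for l t
    by (simp add: x_def channel_posterior_nonneg[OF full_support])
  have x1: "x l t \<le> 1" for l t
    by (simp add: x_def channel_posterior_le_1[OF full_support])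
  have w0: "0 \<le> w l t" and u0: "0 \<le> u r t" for l r t
    by (auto simp: w_def u_def)
  have \<alpha>: "\<bar>\<alpha> l\<bar> \<le> \<kappa>" for l
    using \<kappa>[of l] full_support[of l] by (simp add: \<alpha>_def)
  \<comment> \<open>Off the diagonal this is half of the bound on
    \<open>(\<alpha> k - \<alpha> l)\<^sup>2\<close>. On the diagonal that difference is 0, whereas
    the coefficient is 1.\<close>
  define B where "B = (\<lambda>(k::'q) l. if k = l then 0 else 2 * \<kappa>\<^sup>2)"
  have B0: "0 \<le> B k l" for k l by (simp add: B_def)
  \<comment> \<open>Both sides are linear in likelihood ratios and in square roots of their
    products, whose integrals are 1 and Bhattacharyya coefficients.\<close>
  have point: "(\<Sum>l\<in>UNIV. (\<alpha> l)\<^sup>2 * pmf \<pi> l * w l t) + 8 / a * sqrt (u p t * u q t) \<le>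
      4 / a * u p t + 4 / a * u q t + (\<Sum>k\<in>UNIV. \<Sum>l\<in>UNIV. B k l * sqrt (w k t * w l t))"
    if t: "t \<in> set_pmf ?m" for t
  proof -
    have sx: "(\<Sum>l\<in>UNIV. x l t) = 1"
      unfolding x_def by (rule sum_channel_posterior[OF full_support t])
    have u_le: "u r t \<le> 1 / a" for r
    proof -
      have "pmf r l / pmf \<pi> l \<le> 1 / a" for l
        using a pmf_le_1[of r l] by (intro frac_le) auto
      then have "u r t \<le> (\<Sum>l\<in>UNIV. 1 / a * x l t)"
        unfolding u using x0 by (intro sum_mono mult_right_mono) auto
      then show ?thesis using sx by (simp only: sum_distrib_left[symmetric])
    qed
    have diff: "u p t - u q t = (\<Sum>l\<in>UNIV. x l t * \<alpha> l)"
      unfolding u by (simp add: sum_subtractf[symmetric] \<alpha>_def diff_divide_distrib left_diff_distrib right_diff_distrib mult.commute)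
    have "(u p t - u q t)\<^sup>2 = (sqrt (u p t) - sqrt (u q t))\<^sup>2 * (sqrt (u p t) + sqrt (u q t))\<^sup>2"
      using u0 by (simp add: power_mult_distrib[symmetric] algebra_simps)
    also have "\<dots> \<le> (sqrt (u p t) - sqrt (u q t))\<^sup>2 * (4 / a)"
    proof (intro mult_left_mono)
      have "(sqrt (u p t) + sqrt (u q t))\<^sup>2 \<le> 2 * (u p t + u q t)"
        using u0[of p t] u0[of q t] arith_geo_mean_sqrt[of "u p t" "u q t"]
        by (simp add: power2_sum real_sqrt_mult)
      also have "\<dots> \<le> 4 / a"
        using u_le[of p] u_le[of q] by simp
      finally show "(sqrt (u p t) + sqrt (u q t))\<^sup>2 \<le> 4 / a" .
    qed simp
    also have "\<dots> = 4 / a * u p t + 4 / a * u q t - 8 / a * sqrt (u p t * u q t)"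
      using u0 a by (simp add: power2_diff real_sqrt_mult field_simps)
    finally have le: "(\<Sum>l\<in>UNIV. x l t * \<alpha> l)\<^sup>2 \<le> \<dots>"
      unfolding diff .
    have "2 * ((\<Sum>l\<in>UNIV. x l t * (\<alpha> l)\<^sup>2) - (\<Sum>l\<in>UNIV. x l t * \<alpha> l)\<^sup>2) =
        (\<Sum>k\<in>UNIV. \<Sum>l\<in>UNIV. x k t * x l t * (\<alpha> k - \<alpha> l)\<^sup>2)"
      by (rule sum_weighted_square_diff[OF sx, symmetric])
    also have "\<dots> \<le> (\<Sum>k\<in>UNIV. \<Sum>l\<in>UNIV. 2 * (B k l * sqrt (w k t * w l t)))"
    proof (intro sum_mono)
      fix k l
      show "x k t * x l t * (\<alpha> k - \<alpha> l)\<^sup>2 \<le> 2 * (B k l * sqrt (w k t * w l t))"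
      proof (cases "k = l")
        case False
        have "\<bar>\<alpha> k - \<alpha> l\<bar> \<le> 2 * \<kappa>"
          using \<alpha>[of k] \<alpha>[of l] by linarith
        from power_mono[OF this, of 2] have d: "(\<alpha> k - \<alpha> l)\<^sup>2 \<le> 4 * \<kappa>\<^sup>2"
          by (simp add: power_mult_distrib)
        have "x k t * x l t \<le> sqrt (x k t * x l t)"
          using x0[of k t] x0[of l t] x1[of k t] x1[of l t]
          by (intro real_le_rsqrt) (auto simp: power2_eq_square mult_le_one intro!: mult_left_le)
        also have "\<dots> \<le> sqrt (w k t * w l t)"
          unfolding x using w0 by (intro real_sqrt_le_mono mult_mono) (auto simp: mult_left_le_one_le pmf_le_1)
        finally have "x k t * x l t \<le> sqrt (w k t * w l t)" .
        then have "x k t * x l t * (\<alpha> k - \<alpha> l)\<^sup>2 \<le> sqrt (w k t * w l t) * (4 * \<kappa>\<^sup>2)"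
          using d w0 by (intro mult_mono) auto
        then show ?thesis using False by (simp add: B_def ac_simps)
      qed (simp add: B_def)
    qed
    also have "\<dots> = 2 * (\<Sum>k\<in>UNIV. \<Sum>l\<in>UNIV. B k l * sqrt (w k t * w l t))"
      by (simp only: sum_distrib_left)
    finally show ?thesis
      using le by (simp add: x mult.commute mult.left_commute)
  qed
  have lhs: "has_bochner_integral (measure_pmf ?m)
      (\<lambda>t. (\<Sum>l\<in>UNIV. (\<alpha> l)\<^sup>2 * pmf \<pi> l * w l t) + 8 / a * sqrt (u p t * u q t))
      ((\<Sum>l\<in>UNIV. (\<alpha> l)\<^sup>2 * pmf \<pi> l * 1) + 8 / a * bhattacharyya (bind_pmf p W) (bind_pmf q W))"
    unfolding w_def u_def
    by (intro has_bochner_integral_add has_bochner_integral_sum has_bochner_integral_mult_right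
        has_bochner_integral_likelihood_ratio has_bochner_integral_bhattacharyya set_pmf_channel set_pmf_mixture full_support)
  have rhs: "has_bochner_integral (measure_pmf ?m)
      (\<lambda>t. 4 / a * u p t + 4 / a * u q t + (\<Sum>k\<in>UNIV. \<Sum>l\<in>UNIV. B k l * sqrt (w k t * w l t)))
      (4 / a * 1 + 4 / a * 1 + (\<Sum>k\<in>UNIV. \<Sum>l\<in>UNIV. B k l * bhattacharyya (W k) (W l)))"
    unfolding w_def u_def
    by (intro has_bochner_integral_add has_bochner_integral_sum has_bochner_integral_mult_right
        has_bochner_integral_likelihood_ratio has_bochner_integral_bhattacharyya set_pmf_channel set_pmf_mixture full_support)
  have main: "(\<Sum>l\<in>UNIV. (\<alpha> l)\<^sup>2 * pmf \<pi> l) + 8 / a * bhattacharyya (bind_pmf p W) (bind_pmf q W) \<le>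
      8 / a + (\<Sum>k\<in>UNIV. \<Sum>l\<in>UNIV. B k l * bhattacharyya (W k) (W l))"
    using integral_mono_AE[OF integrable.intros[OF lhs] integrable.intros[OF rhs] AE_pmfI[OF point]]
    unfolding has_bochner_integral_integral_eq[OF lhs] has_bochner_integral_integral_eq[OF rhs] by simp
  have "(\<Sum>k\<in>UNIV. \<Sum>l\<in>UNIV. B k l * bhattacharyya (W k) (W l)) \<le> (\<Sum>k\<in>(UNIV::'q set). \<Sum>l\<in>(UNIV::'q set). 2 * \<kappa>\<^sup>2 * \<epsilon>)"
    using \<epsilon> \<open>0 \<le> \<epsilon>\<close> by (intro sum_mono) (auto simp: B_def intro!: mult_left_mono)
  also have "\<dots> = 2 * \<kappa>\<^sup>2 * ?n\<^sup>2 * \<epsilon>"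
    by (simp add: power2_eq_square)
  finally have err: "(\<Sum>k\<in>UNIV. \<Sum>l\<in>UNIV. B k l * bhattacharyya (W k) (W l)) \<le> \<dots>" .
  \<comment> \<open>Cauchy-Schwarz for \<open>\<bar>\<alpha> l\<bar> * pmf \<pi> l\<close>, with
    \<open>pmf \<pi> l\<close> split into two square roots.\<close>
  have "s\<^sup>2 \<le> (\<Sum>l\<in>UNIV. \<bar>pmf p l - pmf q l\<bar>)\<^sup>2"
    using s by (intro power_mono) auto
  also have "\<dots> = (\<Sum>l\<in>UNIV. \<bar>\<alpha> l * sqrt (pmf \<pi> l)\<bar> * \<bar>sqrt (pmf \<pi> l)\<bar>)\<^sup>2"
  proof -
    have "\<bar>pmf p l - pmf q l\<bar> = \<bar>\<alpha> l * sqrt (pmf \<pi> l)\<bar> * \<bar>sqrt (pmf \<pi> l)\<bar>" for l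
      using full_support[of l] by (simp add: \<alpha>_def abs_mult mult.assoc)
    then show ?thesis by simp
  qed
  also have "\<dots> \<le> (\<Sum>l\<in>UNIV. \<bar>\<alpha> l * sqrt (pmf \<pi> l)\<bar>\<^sup>2) * (\<Sum>l\<in>UNIV. \<bar>sqrt (pmf \<pi> l)\<bar>\<^sup>2)"
    by (rule Cauchy_Schwarz_ineq_sum)
  also have "\<dots> = (\<Sum>l\<in>UNIV. (\<alpha> l)\<^sup>2 * pmf \<pi> l)"
    by (simp add: power_mult_distrib sum_pmf_eq_1)
  finally have "s\<^sup>2 + 8 / a * bhattacharyya (bind_pmf p W) (bind_pmf q W) \<le> 8 / a + 2 * \<kappa>\<^sup>2 * ?n\<^sup>2 * \<epsilon>"
    using main err by linarith
  then have "(s\<^sup>2 - 2 * \<kappa>\<^sup>2 * ?n\<^sup>2 * \<epsilon>) \<le> 8 / a * (1 - bhattacharyya (bind_pmf p W) (bind_pmf q W))"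
    by (simp add: right_diff_distrib)
  from mult_left_mono[OF this, of "a / 8"] show ?thesis
    using a by simp
qed

text \<open>The joint law of input and output given the label \<open>j\<close> couples the two
  posteriors. Jensen's inequality passes to the square distance, and conditioning on
  \<open>j\<close> costs a factor of at most \<open>1 / a\<close>.\<close>

lemma posterior_expectation_diff_le:
  fixes W :: "'q \<Rightarrow> 'a pmf" and K :: "'a \<Rightarrow> 'b pmf"
  defines "W' \<equiv> \<lambda>i. bind_pmf (W i) K"
  shows "((\<integral>s. channel_posterior \<pi> W i s \<partial>measure_pmf (W j)) - (\<integral>t. channel_posterior \<pi> W' i t \<partial>measure_pmf (W' j)))\<^sup>2
    \<le> 8 / a * bhattacharyya_gap W K"
proof -
  let ?J = "with_kernel (bind_pmf \<pi> W) K" and ?Jj = "with_kernel (W j) K"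
  define x y where "x z = channel_posterior \<pi> W i (fst z)" and "y z = channel_posterior \<pi> W' i (snd z)" for z
  have int: "integrable (measure_pmf M) x" "integrable (measure_pmf M) y" for M
    unfolding x_def y_def
    by (auto intro!: measure_pmf.integrable_const_bound[where B = 1] simp: channel_posterior_nonneg[OF full_support] channel_posterior_le_1[OF full_support])
  have bound: "\<bar>x z - y z\<bar> \<le> 1" for z
    using channel_posterior_nonneg[OF full_support, of W i "fst z"] channel_posterior_le_1[OF full_support, of W i "fst z"]
      channel_posterior_nonneg[OF full_support, of W' i "snd z"] channel_posterior_le_1[OF full_support, of W' i "snd z"]
    by (simp add: x_def y_def abs_le_iff)
  have int2: "integrable (measure_pmf M) (\<lambda>z. (x z - y z)\<^sup>2)" for M
    by (rule measure_pmf.integrable_const_bound[where B = 1]) (auto simp: abs_square_le_1 bound)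
  have "(\<integral>s. channel_posterior \<pi> W i s \<partial>measure_pmf (W j)) = (\<integral>z. x z \<partial>measure_pmf ?Jj)"
    using integral_map_pmf[of fst ?Jj "channel_posterior \<pi> W i"] by (simp add: map_fst_with_kernel x_def)
  moreover have "(\<integral>t. channel_posterior \<pi> W' i t \<partial>measure_pmf (W' j)) = (\<integral>z. y z \<partial>measure_pmf ?Jj)"
    using integral_map_pmf[of snd ?Jj "channel_posterior \<pi> W' i"] by (simp add: map_snd_with_kernel y_def W'_def)
  ultimately have "((\<integral>s. channel_posterior \<pi> W i s \<partial>measure_pmf (W j)) - (\<integral>t. channel_posterior \<pi> W' i t \<partial>measure_pmf (W' j)))\<^sup>2 =
      (\<integral>z. x z - y z \<partial>measure_pmf ?Jj)\<^sup>2"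
    using int by simp
  \<comment> \<open>Jensen's inequality, as nonnegativity of the variance.\<close>
  also have "\<dots> \<le> (\<integral>z. (x z - y z)\<^sup>2 \<partial>measure_pmf ?Jj)"
    using measure_pmf.variance_eq[of ?Jj "\<lambda>z. x z - y z"] measure_pmf.variance_positive[of ?Jj "\<lambda>z. x z - y z"] int int2
    by simp
  also have "\<dots> \<le> 8 / a * bhattacharyya_gap W K"
  proof -
    let ?F = "\<lambda>z. \<Sum>i\<in>UNIV. (channel_posterior \<pi> W i (fst z) - channel_posterior \<pi> W' i (snd z))\<^sup>2"
    \<comment> \<open>The law given \<open>j\<close> enters this mixture with weight
      \<open>pmf \<pi> j\<close>, so it is bounded by the whole.\<close>
    have J: "?J = bind_pmf \<pi> (\<lambda>i. with_kernel (W i) K)"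
      by (simp add: with_kernel_def bind_assoc_pmf)
    have "ennreal (pmf \<pi> j) * ennreal (\<integral>z. (x z - y z)\<^sup>2 \<partial>measure_pmf ?Jj) =
        ennreal (pmf \<pi> j) * (\<integral>\<^sup>+z. ennreal ((x z - y z)\<^sup>2) \<partial>measure_pmf ?Jj)"
      using int2 by (subst nn_integral_eq_integral) auto
    also have "\<dots> \<le> ennreal (pmf \<pi> j) * (\<integral>\<^sup>+z. ennreal (?F z) \<partial>measure_pmf ?Jj)"
      unfolding x_def y_def
      by (intro mult_left_mono nn_integral_mono ennreal_leI member_le_sum[of i UNIV]) auto
    also have "\<dots> \<le> (\<Sum>k\<in>UNIV. (\<integral>\<^sup>+z. ennreal (?F z) \<partial>measure_pmf (with_kernel (W k) K)) * ennreal (pmf \<pi> k))"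
      using member_le_sum[of j UNIV "\<lambda>k. (\<integral>\<^sup>+z. ennreal (?F z) \<partial>measure_pmf (with_kernel (W k) K)) * ennreal (pmf \<pi> k)"]
      by (simp add: mult.commute)
    also have "\<dots> = (\<integral>\<^sup>+z. ennreal (?F z) \<partial>measure_pmf ?J)"
      unfolding J nn_integral_bind_pmf by (subst nn_integral_measure_pmf_support[of UNIV]) auto
    also have "\<dots> \<le> ennreal (8 * bhattacharyya_gap W K)"
      unfolding W'_def by (rule nn_integral_posterior_dist_le[OF full_support])
    finally have "pmf \<pi> j * (\<integral>z. (x z - y z)\<^sup>2 \<partial>measure_pmf ?Jj) \<le> 8 * bhattacharyya_gap W K"
      by (subst (asm) ennreal_mult[symmetric]) (auto simp: bhattacharyya_gap_nonneg)
    moreover have "a * (\<integral>z. (x z - y z)\<^sup>2 \<partial>measure_pmf ?Jj) \<le> pmf \<pi> j * (\<integral>z. (x z - y z)\<^sup>2 \<partial>measure_pmf ?Jj)"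
      using a by (intro mult_right_mono) auto
    ultimately show ?thesis
      using a by (simp add: field_simps)
  qed
  finally show ?thesis .
qed
end

section \<open>Spectral bounds for the transition matrix\<close>

lemma diag_matrix_mult: "(diag v ** A) $ i $ j = v $ i * A $ i $ j"
proof -
  have "(\<Sum>k\<in>UNIV. (if i = k then v $ i else 0) * A $ k $ j) = (\<Sum>k\<in>UNIV. if i = k then v $ i * A $ k $ j else 0)"
    by (intro sum.cong) auto
  then show ?thesis by (simp add: matrix_matrix_mult_def diag_def)
qed

lemma matrix_mult_diag: "(A ** diag v) $ i $ j = A $ i $ j * v $ j"
proof -
  have "(\<Sum>k\<in>UNIV. A $ i $ k * (if k = j then v $ k else 0)) = (\<Sum>k\<in>UNIV. if k = j then A $ i $ k * v $ k else 0)"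
    by (intro sum.cong) auto
  then show ?thesis by (simp add: matrix_matrix_mult_def diag_def)
qed

lemma invertible_diag:
  assumes "\<And>i. v $ i \<noteq> 0"
  shows "invertible (diag v)"
proof -
  have "diag v ** diag (\<chi> i. inverse (v $ i)) = mat 1"
    by (simp add: vec_eq_iff diag_matrix_mult) (simp add: diag_def mat_def assms)
  moreover have "diag (\<chi> i. inverse (v $ i)) ** diag v = mat 1"
    by (simp add: vec_eq_iff diag_matrix_mult) (simp add: diag_def mat_def assms)
  ultimately show ?thesis unfolding invertible_def by blast
qed

text \<open>Index \<open>k\<close> is list position \<open>k - 1\<close>, so
  \<open>nth_index 1\<close> is the least element. With decreasing eigenvalues, all but the leading
  one are then at most \<open>l $ nth_index 2\<close>.\<close>

lemma nth_index_1_or_ge_2: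
  fixes k :: "'q :: {finite, linorder}"
  assumes "CARD('q) \<ge> 2" "k \<noteq> nth_index 1"
  shows "nth_index 2 \<le> k"
proof -
  let ?xs = "sorted_list_of_set (UNIV :: 'q set)"
  obtain n where n: "n < length ?xs" "k = ?xs ! n"
    by (metis UNIV_I finite_class.finite_UNIV in_set_conv_nth set_sorted_list_of_set)
  with assms have "n \<noteq> 0"
    by (intro notI) (simp add: nth_index_def)
  then have "?xs ! 1 \<le> ?xs ! n"
    using n by (intro sorted_nth_mono) auto
  then show ?thesis using n by (simp add: nth_index_def)
qed

text \<open>Maximum principle: at an index \<open>m\<close> where \<open>v\<close> is largest, the
  average of the nonnegative differences \<open>v m - v k\<close> with positive weights vanishes, so
  each of them does.\<close>

lemma positive_stochastic_fixed_constant: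
  fixes P :: "'q :: finite rmat" and v :: "'q \<Rightarrow> real"
  assumes P: "stochastic_matrix P" "\<And>i j. 0 < P $ i $ j"
    and fixed: "\<And>i. (\<Sum>j\<in>UNIV. P $ i $ j * v j) = v i"
  shows "v i = v j"
proof -
  have "Max (range v) \<in> range v"
    by (intro Max_in) auto
  then obtain m where m: "Max (range v) = v m" by (rule imageE)
  have le: "v k \<le> v m" for k
    unfolding m[symmetric] by (intro Max_ge) auto
  have "(\<Sum>k\<in>UNIV. P $ m $ k * (v m - v k)) = (\<Sum>k\<in>UNIV. P $ m $ k) * v m - v m"
    using fixed[of m] by (simp add: right_diff_distrib sum_subtractf sum_distrib_right)
  also have "\<dots> = 0"
    using P(1) by (simp add: stochastic_matrix_def)
  finally have "\<forall>k\<in>UNIV. P $ m $ k * (v m - v k) = 0"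
  proof (subst (asm) sum_nonneg_eq_0_iff)
    show "0 \<le> P $ m $ k * (v m - v k)" for k
      using le[of k] P(2)[of m k] by simp
  qed auto
  then have "v k = v m" for k
    using P(2)[of m k] by (auto dest: spec[of _ k])
  then show ?thesis by metis
qed

section \<open>Spectral expansion of a reversible transition matrix\<close>

context
  fixes \<pi> :: "'q :: {finite, linorder} pmf" and a :: real
    and P U :: "'q rmat" and l :: "'q rvec"
  assumes a: "0 < a" "\<And>i. a \<le> pmf \<pi> i"
    and reversible: "reversible \<pi> P" and spectral: "spectral_decomposition \<pi> P U l"
begin

lemma prior_pos: "0 < pmf \<pi> i"
  using a(1) a(2)[of i] by linarith

lemma eigvec_nth: "eigvec \<pi> U k $ i = U $ k $ i / sqrt (pmf \<pi> i)"
  using prior_pos[of i] powr_half_sqrt[of "pmf \<pi> i"]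
  by (simp add: eigvec_def powr_minus_divide)

lemma orthogonal_columns: "(\<Sum>k\<in>UNIV. U $ k $ i * U $ k $ j) = (if i = j then 1 else 0)"
proof -
  have "transpose U ** U = mat 1"
    using spectral by (simp add: spectral_decomposition_def orthogonal_matrix_def)
  then have "(transpose U ** U) $ i $ j = mat 1 $ i $ j" by simp
  then show ?thesis by (simp add: matrix_matrix_mult_def transpose_def mat_def)
qed

text \<open>The decomposition gives \<open>V ** P = diag l ** V\<close>, so the rows of
  \<open>V\<close> are left eigenvectors. Their entries are those of \<open>eigvec\<close> times
  \<open>\<pi>\<close>, and reversibility turns them into right eigenvectors.\<close>

lemma eigvec_eigenvector: "(\<Sum>j\<in>UNIV. P $ i $ j * eigvec \<pi> U k $ j) = l $ k * eigvec \<pi> U k $ i"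
proof -
  define V where "V = U ** diag (\<chi> i. sqrt (pmf \<pi> i))"
  have "invertible U"
    using spectral by (auto simp: spectral_decomposition_def orthogonal_matrix_def invertible_def)
  moreover have "pmf \<pi> i \<noteq> 0" for i
    using prior_pos[of i] by simp
  then have "invertible (diag (\<chi> i. sqrt (pmf \<pi> i)))"
    by (intro invertible_diag) simp
  ultimately have "invertible V"
    unfolding V_def by (rule invertible_mult)
  have "P = matrix_inv V ** diag l ** V"
    using spectral by (simp add: spectral_decomposition_def V_def Let_def)
  then have "V ** P = (V ** matrix_inv V) ** (diag l ** V)"
    by (simp add: matrix_mul_assoc)
  also have "\<dots> = diag l ** V"
    using someI_ex[OF \<open>invertible V\<close>[unfolded invertible_def]] by (simp add: matrix_inv_def)
  finally have entry: "(V ** P) $ k $ i = (diag l ** V) $ k $ i" by simp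
  then have left: "(\<Sum>j\<in>UNIV. U $ k $ j * sqrt (pmf \<pi> j) * P $ j $ i) = l $ k * (U $ k $ i * sqrt (pmf \<pi> i))"
  proof -
    have "(V ** P) $ k $ i = (\<Sum>j\<in>UNIV. V $ k $ j * P $ j $ i)"
      by (simp add: matrix_matrix_mult_def)
    then show ?thesis
      using entry unfolding diag_matrix_mult by (simp add: V_def matrix_mult_diag)
  qed
  have summand: "U $ k $ j * sqrt (pmf \<pi> j) * P $ j $ i = pmf \<pi> i * (P $ i $ j * eigvec \<pi> U k $ j)" for j
  proof -
    have "U $ k $ j * sqrt (pmf \<pi> j) = pmf \<pi> j * eigvec \<pi> U k $ j"
      using prior_pos[of j] by (simp add: eigvec_nth real_div_sqrt field_simps)
    moreover have "pmf \<pi> j * P $ j $ i = pmf \<pi> i * P $ i $ j"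
      using reversible by (simp add: reversible_def)
    ultimately show ?thesis by (simp add: algebra_simps)
  qed
  have "pmf \<pi> i * (\<Sum>j\<in>UNIV. P $ i $ j * eigvec \<pi> U k $ j) = l $ k * (U $ k $ i * sqrt (pmf \<pi> i))"
    using left by (simp add: summand sum_distrib_left)
  also have "\<dots> = pmf \<pi> i * (l $ k * eigvec \<pi> U k $ i)"
    using prior_pos[of i] by (simp add: eigvec_nth real_div_sqrt field_simps)
  finally show ?thesis
    using prior_pos[of i] by simp
qed

text \<open>Completeness: the columns of \<open>U\<close> are orthonormal, so the products of the
  entries \<open>m\<close> and \<open>j\<close> of the eigenvectors sum to
  \<open>1 / pmf \<pi> j\<close> if \<open>m = j\<close> and to 0 otherwise.\<close>

lemma kernel_expansion: "P $ i $ j / pmf \<pi> j = (\<Sum>k\<in>UNIV. l $ k * eigvec \<pi> U k $ i * eigvec \<pi> U k $ j)"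
proof -
  have "(\<Sum>k\<in>UNIV. l $ k * eigvec \<pi> U k $ i * eigvec \<pi> U k $ j) =
      (\<Sum>k\<in>UNIV. \<Sum>m\<in>UNIV. P $ i $ m * (eigvec \<pi> U k $ m * eigvec \<pi> U k $ j))"
    by (simp add: eigvec_eigenvector[symmetric] sum_distrib_right mult.assoc)
  also have "\<dots> = (\<Sum>m\<in>UNIV. P $ i $ m * (\<Sum>k\<in>UNIV. eigvec \<pi> U k $ m * eigvec \<pi> U k $ j))"
    by (subst sum.swap) (simp add: sum_distrib_left)
  also have "\<dots> = (\<Sum>m\<in>UNIV. if m = j then P $ i $ j / pmf \<pi> j else 0)"
  proof (intro sum.cong refl)
    fix m
    have "(\<Sum>k\<in>UNIV. eigvec \<pi> U k $ m * eigvec \<pi> U k $ j) =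
        (\<Sum>k\<in>UNIV. U $ k $ m * U $ k $ j) / (sqrt (pmf \<pi> m) * sqrt (pmf \<pi> j))"
      by (simp add: eigvec_nth sum_divide_distrib)
    then show "P $ i $ m * (\<Sum>k\<in>UNIV. eigvec \<pi> U k $ m * eigvec \<pi> U k $ j) = (if m = j then P $ i $ j / pmf \<pi> j else 0)"
      by (simp add: orthogonal_columns)
  qed
  finally show ?thesis by simp
qed

lemma eigvec_square_le: "(eigvec \<pi> U k $ i)\<^sup>2 \<le> 1 / a"
proof -
  have "(U $ k $ i)\<^sup>2 \<le> (\<Sum>k\<in>UNIV. (U $ k $ i)\<^sup>2)"
    by (rule member_le_sum) auto
  also have "\<dots> = 1"
    using orthogonal_columns[of i i] by (simp add: power2_eq_square)
  finally show ?thesis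
    using a prior_pos[of i] by (auto simp: eigvec_nth power_divide intro!: frac_le)
qed

lemma abs_eigvec_mult_le: "\<bar>eigvec \<pi> U k $ i * eigvec \<pi> U k $ j\<bar> \<le> 1 / a"
  using eigvec_square_le[of k i] eigvec_square_le[of k j] sum_squares_bound[of "\<bar>eigvec \<pi> U k $ i\<bar>" "\<bar>eigvec \<pi> U k $ j\<bar>"]
  by (simp add: abs_mult)

context
  assumes card: "CARD('q) \<ge> 2" and stochastic: "stochastic_matrix P" and pos: "\<And>i j. 0 < P $ i $ j"
    and l1: "l $ nth_index 1 = 1" and l_mono: "\<And>i j. i \<le> j \<Longrightarrow> l $ j \<le> l $ i" and l_nonneg: "\<And>i. 0 \<le> l $ i"
begin

lemma eigvec_1_constant: "eigvec \<pi> U (nth_index 1) $ i = eigvec \<pi> U (nth_index 1) $ j"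
  using eigvec_eigenvector[of _ "nth_index 1"] l1
  by (intro positive_stochastic_fixed_constant[OF stochastic pos, where v = "\<lambda>i. eigvec \<pi> U (nth_index 1) $ i"]) simp

text \<open>In \<open>kernel_expansion\<close> the leading eigenvector is constant and annihilates
  \<open>h\<close>. Every other term has an eigenvalue of at most \<open>l $ nth_index 2\<close> and
  a product of eigenvector entries of at most \<open>1 / a\<close>; the number of terms gives
  \<open>CARD('q)\<close>.\<close>

lemma kernel_contraction:
  fixes h :: "'q \<Rightarrow> real"
  assumes h: "(\<Sum>j\<in>UNIV. h j) = 0"
  shows "\<bar>\<Sum>j\<in>UNIV. P $ i $ j / pmf \<pi> j * h j\<bar> \<le> l $ nth_index 2 * real CARD('q) / a * (\<Sum>j\<in>UNIV. \<bar>h j\<bar>)"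
proof -
  let ?e = "\<lambda>k i. eigvec \<pi> U k $ i"
  have "(\<Sum>j\<in>UNIV. P $ i $ j / pmf \<pi> j * h j) = (\<Sum>j\<in>UNIV. \<Sum>k\<in>UNIV. l $ k * (?e k i * ?e k j * h j))"
    unfolding kernel_expansion by (simp add: sum_distrib_right mult.assoc)
  also have "\<dots> = (\<Sum>k\<in>UNIV. l $ k * (\<Sum>j\<in>UNIV. ?e k i * ?e k j * h j))"
    by (subst sum.swap) (simp add: sum_distrib_left)
  also have "\<bar>\<dots>\<bar> \<le> (\<Sum>k\<in>UNIV. \<bar>l $ k * (\<Sum>j\<in>UNIV. ?e k i * ?e k j * h j)\<bar>)"
    by (rule sum_abs)
  also have "\<dots> \<le> (\<Sum>k\<in>(UNIV :: 'q set). l $ nth_index 2 * (1 / a * (\<Sum>j\<in>UNIV. \<bar>h j\<bar>)))"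
  proof (intro sum_mono)
    fix k
    have *: "0 \<le> 1 / a * (\<Sum>j\<in>UNIV. \<bar>h j\<bar>)"
      using a by (intro mult_nonneg_nonneg sum_nonneg) auto
    show "\<bar>l $ k * (\<Sum>j\<in>UNIV. ?e k i * ?e k j * h j)\<bar> \<le> l $ nth_index 2 * (1 / a * (\<Sum>j\<in>UNIV. \<bar>h j\<bar>))"
    proof (cases "k = nth_index 1")
      case True
      have "?e k i * ?e k j * h j = ?e k i * ?e k i * h j" for j
        using eigvec_1_constant[of j i] by (simp only: True)
      then have "(\<Sum>j\<in>UNIV. ?e k i * ?e k j * h j) = (\<Sum>j\<in>UNIV. ?e k i * ?e k i * h j)"
        by (simp only:)
      also have "\<dots> = 0"
        using h by (simp add: sum_distrib_left[symmetric])
      finally show ?thesis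
        using mult_nonneg_nonneg[OF l_nonneg[of "nth_index 2"] *] by simp
    next
      case False
      then have "l $ k \<le> l $ nth_index 2"
        by (intro l_mono nth_index_1_or_ge_2 card)
      moreover have "\<bar>\<Sum>j\<in>UNIV. ?e k i * ?e k j * h j\<bar> \<le> (\<Sum>j\<in>UNIV. \<bar>?e k i * ?e k j\<bar> * \<bar>h j\<bar>)"
        by (rule order_trans[OF sum_abs]) (simp add: abs_mult)
      moreover have "\<dots> \<le> (\<Sum>j\<in>UNIV. 1 / a * \<bar>h j\<bar>)"
        by (intro sum_mono mult_right_mono abs_eigvec_mult_le) auto
      ultimately show ?thesis
        using l_nonneg[of k] * unfolding abs_mult sum_distrib_left[symmetric]
        by (intro mult_mono) auto
    qed
  qed
  also have "\<dots> = l $ nth_index 2 * real CARD('q) / a * (\<Sum>j\<in>UNIV. \<bar>h j\<bar>)"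
    by simp
  finally show ?thesis .
qed

text \<open>The contraction is applied to a difference of two unit vectors, whose absolute sum is at
  most 2. By reversibility \<open>P $ k $ m / pmf \<pi> m\<close> is symmetric in \<open>k\<close>
  and \<open>m\<close>, so row \<open>k\<close> can be read as a column.\<close>

lemma kernel_row_diff: "\<bar>P $ i $ k - P $ j $ k\<bar> / pmf \<pi> k \<le> 2 * real CARD('q) / a * l $ nth_index 2"
proof -
  let ?h = "\<lambda>m. (if m = i then 1 else 0) - (if m = j then 1 else 0 :: real)"
  have sym: "P $ k $ m / pmf \<pi> m = P $ m $ k / pmf \<pi> k" for m
    using reversible prior_pos[of m] prior_pos[of k]
    by (simp add: reversible_def field_simps)
  have "(\<Sum>m\<in>UNIV. P $ k $ m / pmf \<pi> m * ?h m) = (P $ i $ k - P $ j $ k) / pmf \<pi> k"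
  proof -
    have "P $ k $ m / pmf \<pi> m * ?h m =
        (if m = i then P $ i $ k / pmf \<pi> k else 0) - (if m = j then P $ j $ k / pmf \<pi> k else 0)" for m
      using sym[of m] by auto
    then show ?thesis by (simp add: sum_subtractf diff_divide_distrib)
  qed
  then have "\<bar>P $ i $ k - P $ j $ k\<bar> / pmf \<pi> k = \<bar>\<Sum>m\<in>UNIV. P $ k $ m / pmf \<pi> m * ?h m\<bar>"
    using prior_pos[of k] by simp
  also have "\<dots> \<le> l $ nth_index 2 * real CARD('q) / a * (\<Sum>m\<in>UNIV. \<bar>?h m\<bar>)"
    by (rule kernel_contraction) (simp add: sum_subtractf)
  also have "\<dots> \<le> l $ nth_index 2 * real CARD('q) / a * 2"
  proof (rule mult_left_mono)
    have "(\<Sum>m\<in>UNIV. \<bar>?h m\<bar>) \<le> (\<Sum>m\<in>UNIV. (if m = i then 1 else 0) + (if m = j then 1 else 0))"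
      by (intro sum_mono) auto
    then show "(\<Sum>m\<in>UNIV. \<bar>?h m\<bar>) \<le> 2"
      by (simp add: sum.distrib)
  qed (use a l_nonneg in auto)
  finally show ?thesis by (simp add: ac_simps)
qed

end
end

section \<open>Laws of the observed levels\<close>

text \<open>As a function of \<open>i\<close> this is a channel from the root label to the
  observation, noiseless for \<open>f = fst\<close> and noisy for \<open>f = snd\<close>.\<close>

definition level_law ::
  "('q \<times> 'q \<Rightarrow> 'q) \<Rightarrow> real \<Rightarrow> 'q rmat \<Rightarrow> 'q rmat \<Rightarrow> nat \<Rightarrow> 'q :: finite \<Rightarrow> 'q option tree pmf" where
  "level_law f d P \<Delta> n i = map_pmf (reveal_level f n) (broadcast_from d P \<Delta> n i)"

lemma level_law_0:
  "level_law f d P \<Delta> 0 i = map_pmf (\<lambda>t. Node (Some (f (i, t))) []) (row_pmf \<Delta> i)"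
  by (simp add: level_law_def map_bind_pmf) (simp add: map_pmf_def)

text \<open>The root label is hidden when a deeper level is revealed. What remains is a Poisson
  number of independent subtrees, each drawing its root label from row \<open>i\<close> and then its
  own observation.\<close>

lemma level_law_Suc:
  "level_law f d P \<Delta> (Suc n) i =
    map_pmf (Node None) (compound_poisson d (bind_pmf (row_pmf P i) (level_law f d P \<Delta> n)))"
proof -
  define R where "R = do {j \<leftarrow> row_pmf P i; broadcast_from d P \<Delta> n j}"
  have R: "map_pmf (reveal_level f n) R = bind_pmf (row_pmf P i) (level_law f d P \<Delta> n)"
    by (simp add: R_def map_bind_pmf level_law_def[abs_def])
  have "level_law f d P \<Delta> (Suc n) i =
      do {k \<leftarrow> poisson_pmf d; ts \<leftarrow> map_pmf (map (reveal_level f n)) (replicate_pmf k R); return_pmf (Node None ts)}"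
    by (simp add: level_law_def R_def[symmetric] map_bind_pmf bind_map_pmf)
  then show ?thesis
    unfolding map_map_replicate_pmf R by (simp add: compound_poisson_def map_pmf_def bind_assoc_pmf)
qed

lemma inj_Node: "inj (Node x)"
  by (auto simp: inj_def)

lemma bhattacharyya_level_law_Suc:
  assumes "0 < d"
  shows "bhattacharyya (level_law f d P \<Delta> (Suc n) i) (level_law f d P \<Delta> (Suc n) j) =
    exp (- d * (1 - bhattacharyya (bind_pmf (row_pmf P i) (level_law f d P \<Delta> n)) (bind_pmf (row_pmf P j) (level_law f d P \<Delta> n))))"
  unfolding level_law_Suc bhattacharyya_map_inj[OF inj_Node] by (rule bhattacharyya_compound_poisson[OF assms])

text \<open>Noise acts independently on the revealed labels: at level 0 the kernel resamples the
  visible label by \<open>\<Delta>\<close>, and deeper down it acts on each subtree separately, so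
  one kernel serves all root labels.\<close>

lemma level_law_noise_kernel:
  "\<exists>K. \<forall>i. level_law snd d P \<Delta> n i = bind_pmf (level_law fst d P \<Delta> n i) K"
proof (induction n)
  case 0
  \<comment> \<open>At level 0 the root of the observation carries \<open>Some i\<close>, so
    \<open>the\<close> meets no \<open>None\<close>.\<close>
  define K :: "'a option tree \<Rightarrow> 'a option tree pmf" where
    "K t = map_pmf (\<lambda>x. Node (Some x) []) (row_pmf \<Delta> (the (root t)))" for t
  have "level_law snd d P \<Delta> 0 i = bind_pmf (level_law fst d P \<Delta> 0 i) K" for i
    by (simp add: level_law_0 K_def bind_return_pmf)
  then show ?case by blast
next
  case (Suc n)
  then obtain K where K: "level_law snd d P \<Delta> n = (\<lambda>i. bind_pmf (level_law fst d P \<Delta> n i) K)"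
    by blast
  obtain L where L: "\<And>k p. bind_pmf (replicate_pmf k p) L = replicate_pmf k (bind_pmf p K)"
    using bind_replicate_pmf[of K] by blast
  have "level_law snd d P \<Delta> (Suc n) i =
      bind_pmf (level_law fst d P \<Delta> (Suc n) i) (\<lambda>t. map_pmf (Node None) (L (children t)))" for i
  proof -
    have "bind_pmf (row_pmf P i) (level_law snd d P \<Delta> n) = bind_pmf (bind_pmf (row_pmf P i) (level_law fst d P \<Delta> n)) K"
      by (simp add: bind_assoc_pmf K)
    then show ?thesis
      unfolding level_law_Suc by (simp add: compound_poisson_def bind_map_pmf map_bind_pmf[symmetric] bind_assoc_pmf L)
  qed
  then show ?case by blast
qed

lemma fst_root_broadcast_from: "t \<in> set_pmf (broadcast_from d P \<Delta> n i) \<Longrightarrow> fst (root t) = i"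
  by (cases n) auto

lemma integral_row_pmf:
  fixes f :: "'q :: finite \<Rightarrow> real"
  assumes "stochastic_matrix A"
  shows "(\<integral>j. f j \<partial>measure_pmf (row_pmf A i)) = (\<Sum>j\<in>UNIV. A $ i $ j * f j)"
  by (subst integral_measure_pmf_real[of UNIV]) (auto simp: pmf_row_pmf[OF assms] mult.commute)

text \<open>
  The statistic sums \<open>h\<close> over the labels of level \<open>n\<close>, divided by \<open>(\<mu> * d) ^ n\<close>; the preimage \<open>h\<close> of the
  eigenvector \<open>v\<close> under the noise matrix makes it unbiased for \<open>v\<close> at the root.
\<close>

lemma census_statistic:
  fixes P \<Delta> :: "'q :: finite rmat" and h v :: "'q \<Rightarrow> real"
  assumes d: "0 < d" and P: "stochastic_matrix P" and \<Delta>: "stochastic_matrix \<Delta>"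
    and h: "\<And>i. (\<Sum>j\<in>UNIV. \<Delta> $ i $ j * h j) = v i"
    and v: "\<And>i. (\<Sum>j\<in>UNIV. P $ i $ j * v j) = \<mu> * v i" "\<And>i. (v i)\<^sup>2 \<le> b"
    and C: "2 \<le> C" "C \<le> \<mu>\<^sup>2 * d"
  shows "\<exists>V. \<forall>n. \<exists>f :: 'q option tree \<Rightarrow> real. \<forall>i.
    integrable (measure_pmf (level_law snd d P \<Delta> n i)) f \<and> integrable (measure_pmf (level_law snd d P \<Delta> n i)) (\<lambda>t. (f t)\<^sup>2) \<and>
    (\<integral>t. f t \<partial>measure_pmf (level_law snd d P \<Delta> n i)) = v i \<and>
    (\<integral>t. (f t)\<^sup>2 \<partial>measure_pmf (level_law snd d P \<Delta> n i)) \<le> (v i)\<^sup>2 + (V / 2 ^ n + 2 * b / C)"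
proof -
  let ?L = "level_law snd d P \<Delta>"
  have b: "0 \<le> b"
    using v(2) zero_le_power2 order_trans by blast
  \<comment> \<open>Bounds the second moment at level 0 for every root label, as the entries of
    \<open>\<Delta>\<close> are at most 1.\<close>
  define V where "V = (\<Sum>j\<in>UNIV. (h j)\<^sup>2)"
  \<comment> \<open>Variance bound at level \<open>n\<close>. One more level maps a bound
    \<open>e\<close> to \<open>(b + e) / (\<mu>\<^sup>2 * d)\<close>; as
    \<open>\<mu>\<^sup>2 * d \<ge> C \<ge> 2\<close>, this halves the initial part and keeps the
    rest below \<open>2 * b / C\<close>.\<close>
  define e where "e n = V / 2 ^ n + 2 * b / C" for n
  have V: "0 \<le> V"
    unfolding V_def by (intro sum_nonneg) auto
  have e_Suc: "(b + e n) / (\<mu>\<^sup>2 * d) \<le> e (Suc n)" for n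
  proof -
    have "0 \<le> e n"
      using V b C by (simp add: e_def)
    then have "(b + e n) / (\<mu>\<^sup>2 * d) \<le> (b + e n) / C"
      using b C by (intro divide_left_mono) auto
    also have "\<dots> = V / 2 ^ n / C + (b + 2 * b / C) / C"
      by (simp add: e_def add_divide_distrib)
    also have "\<dots> \<le> V / 2 ^ n / 2 + (b + b) / C"
    proof (intro add_mono divide_left_mono divide_right_mono)
      show "2 * b / C \<le> b"
        using mult_right_mono[OF C(1) b] C by (simp add: field_simps)
    qed (use V C in auto)
    finally show ?thesis by (simp add: e_def)
  qed
  have "\<exists>f :: 'q option tree \<Rightarrow> real. \<forall>i.
      integrable (measure_pmf (?L n i)) f \<and> integrable (measure_pmf (?L n i)) (\<lambda>t. (f t)\<^sup>2) \<and>
      (\<integral>t. f t \<partial>measure_pmf (?L n i)) = v i \<and> (\<integral>t. (f t)\<^sup>2 \<partial>measure_pmf (?L n i)) \<le> (v i)\<^sup>2 + e n" for n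
  proof (induction n)
    case 0
    define f :: "'q option tree \<Rightarrow> real" where "f t = h (the (root t))" for t
    have "(\<integral>t. (f t)\<^sup>2 \<partial>measure_pmf (?L 0 i)) \<le> (v i)\<^sup>2 + e 0" for i
    proof -
      have "(\<Sum>j\<in>UNIV. \<Delta> $ i $ j * (h j)\<^sup>2) \<le> V"
        unfolding V_def
      proof (intro sum_mono mult_left_le_one_le)
        fix j
        show "\<Delta> $ i $ j \<le> 1" "0 \<le> \<Delta> $ i $ j"
          using pmf_le_1[of "row_pmf \<Delta> i" j] pmf_nonneg[of "row_pmf \<Delta> i" j] by (auto simp: pmf_row_pmf[OF \<Delta>])
      qed auto
      also have "\<dots> \<le> (v i)\<^sup>2 + e 0"
        using b C by (simp add: e_def)
      finally show ?thesis
        by (simp add: level_law_0 f_def integral_row_pmf[OF \<Delta>])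
    qed
    moreover have "(\<integral>t. f t \<partial>measure_pmf (?L 0 i)) = v i" for i
      by (simp add: level_law_0 f_def integral_row_pmf[OF \<Delta>] h)
    moreover have "integrable (measure_pmf (?L 0 i)) g" for i and g :: "'q option tree \<Rightarrow> real"
      by (simp add: level_law_0 integrable_measure_pmf_finite)
    ultimately show ?case by blast
  next
    case (Suc n)
    then obtain f :: "'q option tree \<Rightarrow> real" where f: "\<And>i. integrable (measure_pmf (?L n i)) f"
      "\<And>i. integrable (measure_pmf (?L n i)) (\<lambda>t. (f t)\<^sup>2)"
      "\<And>i. (\<integral>t. f t \<partial>measure_pmf (?L n i)) = v i"
      "\<And>i. (\<integral>t. (f t)\<^sup>2 \<partial>measure_pmf (?L n i)) \<le> (v i)\<^sup>2 + e n"
      by blast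
    \<comment> \<open>Summing over the children multiplies the mean by \<open>d * \<mu>\<close>,
      which the normalisation undoes.\<close>
    define g :: "'q option tree \<Rightarrow> real" where "g t = sum_list (map f (children t)) / (d * \<mu>)" for t
    have \<mu>: "\<mu> \<noteq> 0" using C by auto
    have "integrable (measure_pmf (?L (Suc n) i)) g \<and> integrable (measure_pmf (?L (Suc n) i)) (\<lambda>t. (g t)\<^sup>2) \<and>
      (\<integral>t. g t \<partial>measure_pmf (?L (Suc n) i)) = v i \<and> (\<integral>t. (g t)\<^sup>2 \<partial>measure_pmf (?L (Suc n) i)) \<le> (v i)\<^sup>2 + e (Suc n)" for i
    proof -
      let ?R = "bind_pmf (row_pmf P i) (?L n)"
      have m1: "has_bochner_integral (measure_pmf ?R) f (\<Sum>j\<in>UNIV. P $ i $ j * v j)"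
        using has_bochner_integral_bind_pmf[of "row_pmf P i" "?L n" f] f
        by (simp add: integrable_measure_pmf_finite integral_row_pmf[OF P])
      have m2: "has_bochner_integral (measure_pmf ?R) (\<lambda>t. (f t)\<^sup>2) (\<Sum>j\<in>UNIV. P $ i $ j * (\<integral>t. (f t)\<^sup>2 \<partial>measure_pmf (?L n j)))"
        using has_bochner_integral_bind_pmf_nonneg[of "row_pmf P i" "?L n" "\<lambda>t. (f t)\<^sup>2"] f
        by (simp add: integrable_measure_pmf_finite integral_row_pmf[OF P])
      define w where "w = (\<Sum>j\<in>UNIV. P $ i $ j * (\<integral>t. (f t)\<^sup>2 \<partial>measure_pmf (?L n j)))"
      have "(\<integral>t. (f t)\<^sup>2 \<partial>measure_pmf (?L n j)) \<le> b + e n" for j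
        using f(4)[of j] v(2)[of j] by linarith
      then have "w \<le> (\<Sum>j\<in>UNIV. P $ i $ j * (b + e n))"
        unfolding w_def using P by (intro sum_mono mult_left_mono) (auto simp: stochastic_matrix_def)
      also have "\<dots> = b + e n"
        using P by (simp add: sum_distrib_right[symmetric] stochastic_matrix_def)
      finally have w: "w \<le> b + e n" .
      have R: "integrable (measure_pmf ?R) f" "integrable (measure_pmf ?R) (\<lambda>t. (f t)\<^sup>2)"
        "(\<integral>t. f t \<partial>measure_pmf ?R) = \<mu> * v i" "(\<integral>t. (f t)\<^sup>2 \<partial>measure_pmf ?R) = w"
        using m1 m2 v(1) by (simp_all add: has_bochner_integral_iff w_def)
      from compound_poisson_moments[OF d R]
      have S: "integrable (measure_pmf (compound_poisson d ?R)) (\<lambda>xs. sum_list (map f xs))"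
        "(\<integral>xs. sum_list (map f xs) \<partial>measure_pmf (compound_poisson d ?R)) = d * (\<mu> * v i)"
        "integrable (measure_pmf (compound_poisson d ?R)) (\<lambda>xs. (sum_list (map f xs))\<^sup>2)"
        "(\<integral>xs. (sum_list (map f xs))\<^sup>2 \<partial>measure_pmf (compound_poisson d ?R)) = d * w + (d * (\<mu> * v i))\<^sup>2"
        by (auto simp: has_bochner_integral_iff)
      \<comment> \<open>The variance \<open>d * w\<close> of the sum becomes
        \<open>w / (\<mu>\<^sup>2 * d)\<close> after normalisation.\<close>
      have "(d * w + (d * (\<mu> * v i))\<^sup>2) / (d * \<mu>)\<^sup>2 = (v i)\<^sup>2 + w / (\<mu>\<^sup>2 * d)"
        using d \<mu> by (simp add: power2_eq_square field_simps)
      also have "\<dots> \<le> (v i)\<^sup>2 + (b + e n) / (\<mu>\<^sup>2 * d)"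
        using w d by (intro add_left_mono divide_right_mono) auto
      also have "\<dots> \<le> (v i)\<^sup>2 + e (Suc n)"
        using e_Suc by simp
      finally show ?thesis
        using S d \<mu> by (simp add: level_law_Suc g_def power_divide)
    qed
    then show ?case by blast
  qed
  then show ?thesis unfolding e_def by blast
qed

text \<open>The census statistic has mean \<open>v i\<close> or \<open>v j\<close> and, for large
  \<open>n\<close>, variance at most \<open>3 * b / C\<close>, so
  \<open>bhattacharyya_le_deviation\<close> applies. Inverting the noise matrix supplies the
  preimage of \<open>v\<close>.\<close>

lemma level_law_distinguishable:
  fixes P \<Delta> :: "'q :: finite rmat" and v :: "'q \<Rightarrow> real"
  assumes d: "0 < d" and P: "stochastic_matrix P" and \<Delta>: "stochastic_matrix \<Delta>" "invertible \<Delta>"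
    and v: "\<And>i. (\<Sum>j\<in>UNIV. P $ i $ j * v j) = \<mu> * v i" "\<And>i. (v i)\<^sup>2 \<le> b" and b: "0 < b"
    and C: "2 \<le> C" "C \<le> \<mu>\<^sup>2 * d" and \<delta>: "0 < \<delta>" "\<delta> \<le> \<bar>v i - v j\<bar>"
  shows "\<forall>\<^sub>F n in sequentially. bhattacharyya (level_law snd d P \<Delta> n i) (level_law snd d P \<Delta> n j) \<le> 2 * sqrt (3 * b / C) / \<delta>"
proof -
  let ?L = "level_law snd d P \<Delta>"
  define h where "h = matrix_inv \<Delta> *v (\<chi> i. v i)"
  have "\<Delta> *v h = (\<Delta> ** matrix_inv \<Delta>) *v (\<chi> i. v i)"
    by (simp add: h_def matrix_vector_mul_assoc)
  also have "\<dots> = (\<chi> i. v i)"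
    using someI_ex[OF \<Delta>(2)[unfolded invertible_def]] by (simp add: matrix_inv_def)
  finally have "(\<Delta> *v h) $ i = v i" for i by simp
  then have h: "(\<Sum>j\<in>UNIV. \<Delta> $ i $ j * h $ j) = v i" for i
    by (simp add: matrix_vector_mult_def)
  obtain V where V: "\<And>n. \<exists>f :: 'q option tree \<Rightarrow> real. \<forall>i.
    integrable (measure_pmf (?L n i)) f \<and> integrable (measure_pmf (?L n i)) (\<lambda>t. (f t)\<^sup>2) \<and>
    (\<integral>t. f t \<partial>measure_pmf (?L n i)) = v i \<and>
    (\<integral>t. (f t)\<^sup>2 \<partial>measure_pmf (?L n i)) \<le> (v i)\<^sup>2 + (V / 2 ^ n + 2 * b / C)"
    using census_statistic[OF d P \<Delta>(1) h v C] by blast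
  \<comment> \<open>The transient part of the variance eventually falls below
    \<open>b / C\<close>.\<close>
  have "(\<lambda>n. V * (1 / 2) ^ n) \<longlonglongrightarrow> 0"
    by (intro tendsto_mult_right_zero LIMSEQ_power_zero) simp
  then have "\<forall>\<^sub>F n in sequentially. V * (1 / 2) ^ n < b / C"
    using b C by (intro order_tendstoD(2)) auto
  then show ?thesis
  proof eventually_elim
    case (elim n)
    obtain f :: "'q option tree \<Rightarrow> real" where f: "\<And>i. integrable (measure_pmf (?L n i)) f"
      "\<And>i. integrable (measure_pmf (?L n i)) (\<lambda>t. (f t)\<^sup>2)"
      "\<And>i. (\<integral>t. f t \<partial>measure_pmf (?L n i)) = v i"
      "\<And>i. (\<integral>t. (f t)\<^sup>2 \<partial>measure_pmf (?L n i)) \<le> (v i)\<^sup>2 + (V / 2 ^ n + 2 * b / C)"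
      using V[of n] by blast
    have "(\<integral>\<^sup>+t. ennreal ((f t - v k)\<^sup>2) \<partial>measure_pmf (?L n k)) \<le> ennreal (3 * b / C)" for k
    proof -
      have "integrable (measure_pmf (?L n k)) (\<lambda>t. (f t - v k)\<^sup>2)"
        unfolding power2_diff using f by simp
      then have "(\<integral>\<^sup>+t. ennreal ((f t - v k)\<^sup>2) \<partial>measure_pmf (?L n k)) = ennreal (\<integral>t. (f t - v k)\<^sup>2 \<partial>measure_pmf (?L n k))"
        by (intro nn_integral_eq_integral) auto
      also have "(\<integral>t. (f t - v k)\<^sup>2 \<partial>measure_pmf (?L n k)) = (\<integral>t. (f t)\<^sup>2 \<partial>measure_pmf (?L n k)) - (v k)\<^sup>2"
        using measure_pmf.variance_eq[OF f(1)[of k] f(2)[of k]] unfolding f(3) .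
      also have "\<dots> \<le> 3 * b / C"
      proof -
        have "V / 2 ^ n < b / C"
          using elim by (simp add: power_one_over)
        moreover have "3 * b / C = 2 * b / C + b / C"
          by (simp add: add_divide_distrib[symmetric])
        ultimately show ?thesis using f(4)[of k] by linarith
      qed
      finally show ?thesis by (simp add: ennreal_leI)
    qed
    from bhattacharyya_le_deviation[OF _ this this, of i j]
    have "bhattacharyya (?L n i) (?L n j) * \<bar>v i - v j\<bar> \<le> 2 * sqrt (3 * b / C)"
      using b C by simp
    moreover have "bhattacharyya (?L n i) (?L n j) * \<delta> \<le> bhattacharyya (?L n i) (?L n j) * \<bar>v i - v j\<bar>"
      using \<delta> by (intro mult_left_mono) auto
    ultimately show ?case
      using \<delta> by (simp add: pos_le_divide_eq)
  qed
qed

section \<open>Posteriors on the tree as channel posteriors\<close>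

context
  fixes \<pi> :: "'q :: finite pmf"
  assumes full_support: "\<And>i. 0 < pmf \<pi> i"
begin

text \<open>Bayes' rule for the joint law of root label and observation; for root label
  \<open>k\<close> this law is concentrated on pairs with first entry \<open>k\<close>.\<close>

lemma posterior_eq_channel_posterior:
  "posterior f \<pi> d P \<Delta> n i \<omega> = channel_posterior \<pi> (level_law f d P \<Delta> n) i (reveal_level f n \<omega>)"
proof -
  let ?s = "reveal_level f n \<omega>" and ?B = "broadcast \<pi> d P \<Delta> n"
  have "map_pmf (reveal_level f n) ?B = bind_pmf \<pi> (level_law f d P \<Delta> n)"
    by (simp add: broadcast_def map_bind_pmf level_law_def[abs_def])
  from arg_cong[OF this, of "\<lambda>p. pmf p ?s"]
  have den: "measure (measure_pmf ?B) {t. reveal_level f n t = ?s} = pmf (bind_pmf \<pi> (level_law f d P \<Delta> n)) ?s"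
    by (simp add: pmf_map vimage_def)
  have "map_pmf (\<lambda>t. (fst (root t), reveal_level f n t)) (broadcast_from d P \<Delta> n k) = map_pmf (Pair k) (level_law f d P \<Delta> n k)" for k
    unfolding level_law_def map_pmf_comp
    by (intro map_pmf_cong refl) (auto dest: fst_root_broadcast_from)
  then have "map_pmf (\<lambda>t. (fst (root t), reveal_level f n t)) ?B = bind_pmf \<pi> (\<lambda>k. map_pmf (Pair k) (level_law f d P \<Delta> n k))"
    by (simp add: broadcast_def map_bind_pmf)
  from arg_cong[OF this, of "\<lambda>p. pmf p (i, ?s)"]
  have "measure (measure_pmf ?B) {t. fst (root t) = i \<and> reveal_level f n t = ?s} =
      (\<Sum>k\<in>UNIV. pmf \<pi> k * pmf (map_pmf (Pair k) (level_law f d P \<Delta> n k)) (i, ?s))"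
    by (simp add: pmf_map[of _ ?B] vimage_def pmf_bind_finite)
  also have "\<dots> = (\<Sum>k\<in>UNIV. if k = i then pmf \<pi> i * pmf (level_law f d P \<Delta> n i) ?s else 0)"
  proof (intro sum.cong refl)
    fix k
    have "pmf (map_pmf (Pair k) (level_law f d P \<Delta> n k)) (i, ?s) = (if k = i then pmf (level_law f d P \<Delta> n i) ?s else 0)"
    proof (cases "k = i")
      case True
      then show ?thesis by (simp add: pmf_map_inj' inj_def)
    next
      case False
      then have "(i, ?s) \<notin> set_pmf (map_pmf (Pair k) (level_law f d P \<Delta> n k))" by auto
      then have "pmf (map_pmf (Pair k) (level_law f d P \<Delta> n k)) (i, ?s) = 0" by (simp only: set_pmf_iff not_not)
      with False show ?thesis by simp
    qed
    then show "pmf \<pi> k * pmf (map_pmf (Pair k) (level_law f d P \<Delta> n k)) (i, ?s) =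
        (if k = i then pmf \<pi> i * pmf (level_law f d P \<Delta> n i) ?s else 0)" by simp
  qed
  also have "\<dots> = pmf \<pi> i * pmf (level_law f d P \<Delta> n i) ?s" by simp
  finally show ?thesis
    unfolding posterior_def cond_prob_def by (simp add: den channel_posterior_def likelihood_ratio_def)
qed

lemma cond_broadcast: "cond_pmf (broadcast \<pi> d P \<Delta> n) {t. fst (root t) = j} = broadcast_from d P \<Delta> n j"
proof (rule pmf_eqI)
  fix t
  let ?B = "broadcast \<pi> d P \<Delta> n" and ?A = "{t. fst (root t) = j}"
  have j: "j \<in> set_pmf \<pi>"
    using full_support[of j] by (simp add: set_pmf_iff)
  obtain t' where t': "t' \<in> set_pmf (broadcast_from d P \<Delta> n j)"
    using set_pmf_not_empty[of "broadcast_from d P \<Delta> n j"] by blast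
  have ne: "set_pmf ?B \<inter> ?A \<noteq> {}"
    using j t' fst_root_broadcast_from[OF t'] by (auto simp: broadcast_def)
  have "map_pmf (\<lambda>t. fst (root t)) (broadcast_from d P \<Delta> n k) = map_pmf (\<lambda>_. k) (broadcast_from d P \<Delta> n k)" for k
    by (intro map_pmf_cong refl) (rule fst_root_broadcast_from)
  then have "map_pmf (\<lambda>t. fst (root t)) ?B = \<pi>"
    by (simp add: broadcast_def map_bind_pmf bind_return_pmf')
  from arg_cong[OF this, of "\<lambda>p. pmf p j"] have A: "measure (measure_pmf ?B) ?A = pmf \<pi> j"
    by (simp add: pmf_map vimage_def)
  have zero: "pmf (broadcast_from d P \<Delta> n k) t = 0" if "fst (root t) \<noteq> k" for k
    using that fst_root_broadcast_from[of t d P \<Delta> n k] by (auto simp: set_pmf_iff)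
  have "pmf ?B t = (\<Sum>k\<in>UNIV. if k = fst (root t) then pmf \<pi> k * pmf (broadcast_from d P \<Delta> n k) t else 0)"
    unfolding broadcast_def pmf_bind_finite by (intro sum.cong) (auto simp: zero)
  then have "pmf ?B t = pmf \<pi> (fst (root t)) * pmf (broadcast_from d P \<Delta> n (fst (root t))) t" by simp
  then show "pmf (cond_pmf ?B ?A) t = pmf (broadcast_from d P \<Delta> n j) t"
    using full_support[of j] by (auto simp: pmf_cond[OF ne] A zero)
qed

text \<open>Each posterior depends on the tree only through its own observation, so its expectation
  can be pushed forward to a level law.\<close>

lemma expectation_posterior_diff:
  "measure_pmf.expectation (cond_pmf (broadcast \<pi> d P \<Delta> n) {t. fst (root t) = j})
      (\<lambda>t. X_root \<pi> d P \<Delta> n i t - X_noisy \<pi> d P \<Delta> n i t) =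
    (\<integral>s. channel_posterior \<pi> (level_law fst d P \<Delta> n) i s \<partial>measure_pmf (level_law fst d P \<Delta> n j)) -
    (\<integral>s. channel_posterior \<pi> (level_law snd d P \<Delta> n) i s \<partial>measure_pmf (level_law snd d P \<Delta> n j))"
proof -
  have "integrable (measure_pmf M) (\<lambda>t. channel_posterior \<pi> (level_law f d P \<Delta> n) i (reveal_level f n t))" for f M
    by (auto intro!: measure_pmf.integrable_const_bound[where B = 1] simp: channel_posterior_nonneg[OF full_support] channel_posterior_le_1[OF full_support])
  then show ?thesis
    unfolding cond_broadcast posterior_eq_channel_posterior
    by (simp add: level_law_def[of _ _ _ _ _ j])
qed
end

section \<open>Contraction of the gap from level to level\<close>

text \<open>\<open>bhattacharyya_gap\<close> of the level without naming the noise kernel, which is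
  obtained separately for each level.\<close>

definition level_gap :: "real \<Rightarrow> 'q rmat \<Rightarrow> 'q :: finite rmat \<Rightarrow> nat \<Rightarrow> real" where
  "level_gap d P \<Delta> n = (\<Sum>k\<in>UNIV. \<Sum>l\<in>UNIV.
    bhattacharyya (level_law snd d P \<Delta> n k) (level_law snd d P \<Delta> n l) -
    bhattacharyya (level_law fst d P \<Delta> n k) (level_law fst d P \<Delta> n l))"

lemma obtain_noise_kernel:
  obtains K where "level_law snd d P \<Delta> n = (\<lambda>i. bind_pmf (level_law fst d P \<Delta> n i) K)"
    "level_gap d P \<Delta> n = bhattacharyya_gap (level_law fst d P \<Delta> n) K"
proof -
  obtain K where K: "\<And>i. level_law snd d P \<Delta> n i = bind_pmf (level_law fst d P \<Delta> n i) K"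
    using level_law_noise_kernel[of d P \<Delta> n] by blast
  show ?thesis
    by (rule that[of K]) (simp_all add: fun_eq_iff K level_gap_def bhattacharyya_gap_def)
qed

lemma level_gap_nonneg: "0 \<le> level_gap d P \<Delta> n"
  by (rule obtain_noise_kernel[of d P \<Delta> n]) (simp add: bhattacharyya_gap_nonneg)

text \<open>A further level sends a mixture coefficient \<open>z\<close> to
  \<open>exp (- d * (1 - z))\<close>. Two such values differ by at most the larger one times
  \<open>d\<close> times the difference of the coefficients; \<open>sep\<close> bounds the former
  and \<open>bhattacharyya_mixture_gap_le\<close> the latter.\<close>

lemma level_gap_Suc_le:
  fixes P \<Delta> :: "'q :: finite rmat"
  assumes d: "0 < d" and a: "0 < a" "\<And>i. a \<le> pmf \<pi> i"
    and P: "stochastic_matrix P" and c: "0 < c" "\<And>i j. c \<le> P $ i $ j" and \<kappa>: "0 \<le> \<kappa>"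
    and contr: "\<And>i h. (\<Sum>j\<in>UNIV. h j) = 0 \<Longrightarrow> \<bar>\<Sum>j\<in>UNIV. P $ i $ j / pmf \<pi> j * h j\<bar> \<le> \<kappa> * (\<Sum>j\<in>UNIV. \<bar>h j\<bar>)"
    and sep: "\<And>i j. i \<noteq> j \<Longrightarrow> \<gamma> \<le> 1 - bhattacharyya (bind_pmf (row_pmf P i) (level_law snd d P \<Delta> n)) (bind_pmf (row_pmf P j) (level_law snd d P \<Delta> n))"
  shows "level_gap d P \<Delta> (Suc n) \<le>
    (real CARD('q))\<^sup>2 * (d * exp (- d * \<gamma>) * (4 * \<kappa>\<^sup>2 * real CARD('q) / (a\<^sup>2 * c ^ 3))) * level_gap d P \<Delta> n"
proof -
  let ?M = "4 * \<kappa>\<^sup>2 * real CARD('q) / (a\<^sup>2 * c ^ 3)" and ?g = "level_gap d P \<Delta> n"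
  obtain K where K: "level_law snd d P \<Delta> n = (\<lambda>i. bind_pmf (level_law fst d P \<Delta> n i) K)"
    "?g = bhattacharyya_gap (level_law fst d P \<Delta> n) K"
    by (rule obtain_noise_kernel)
  have Mg: "0 \<le> ?M * ?g"
    using a c(1) by (intro mult_nonneg_nonneg level_gap_nonneg) auto
  have "bhattacharyya (level_law snd d P \<Delta> (Suc n) i) (level_law snd d P \<Delta> (Suc n) j) -
      bhattacharyya (level_law fst d P \<Delta> (Suc n) i) (level_law fst d P \<Delta> (Suc n) j) \<le> exp (- d * \<gamma>) * (d * (?M * ?g))" for i j
  proof (cases "i = j")
    case True
    then show ?thesis using mult_nonneg_nonneg[OF exp_ge_zero mult_nonneg_nonneg[OF less_imp_le[OF d] Mg]] by simp
  next
    case False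
    define A where "A = bhattacharyya (bind_pmf (row_pmf P i) (level_law snd d P \<Delta> n)) (bind_pmf (row_pmf P j) (level_law snd d P \<Delta> n))"
    define B where "B = bhattacharyya (bind_pmf (row_pmf P i) (level_law fst d P \<Delta> n)) (bind_pmf (row_pmf P j) (level_law fst d P \<Delta> n))"
    have row: "bind_pmf (row_pmf P i) (level_law snd d P \<Delta> n) = bind_pmf (bind_pmf (row_pmf P i) (level_law fst d P \<Delta> n)) K" for i
      by (simp add: K(1) bind_assoc_pmf)
    have full: "0 < pmf \<pi> i" for i
      using a(1) a(2)[of i] by linarith
    have c': "c \<le> pmf (row_pmf P i) j" for i j
      unfolding pmf_row_pmf[OF P] by (rule c(2))
    note contr' = contr[folded pmf_row_pmf[OF P]]
    have "A - B \<le> ?M * ?g"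
      unfolding A_def B_def row K(2)
      by (rule bhattacharyya_mixture_gap_le[OF full a c(1) c' c' \<kappa> contr' contr'])
    \<comment> \<open>The exponential of the noisy coefficient \<open>A\<close> is factored out
      because \<open>sep\<close> concerns \<open>A\<close>; the rest is
      \<open>1 - exp (- t) \<le> t\<close>.\<close>
    have "exp (- d * (1 - A)) - exp (- d * (1 - B)) = exp (- d * (1 - A)) * (1 - exp (- (d * (A - B))))"
      by (simp add: right_diff_distrib exp_add[symmetric])
    also have "\<dots> \<le> exp (- d * (1 - A)) * (d * (?M * ?g))"
      using exp_ge_add_one_self[of "- (d * (A - B))"] mult_left_mono[OF \<open>A - B \<le> ?M * ?g\<close>, of d] d
      by (intro mult_left_mono) auto
    also have "\<dots> \<le> exp (- d * \<gamma>) * (d * (?M * ?g))"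
    proof (rule mult_right_mono[OF _ mult_nonneg_nonneg[OF less_imp_le[OF d] Mg]])
      show "exp (- d * (1 - A)) \<le> exp (- d * \<gamma>)"
        using d sep[OF False] by (simp add: A_def)
    qed
    finally show ?thesis
      unfolding bhattacharyya_level_law_Suc[OF d] A_def B_def .
  qed
  then have "level_gap d P \<Delta> (Suc n) \<le> (\<Sum>k\<in>(UNIV::'q set). \<Sum>l\<in>(UNIV::'q set). exp (- d * \<gamma>) * (d * (?M * ?g)))"
    unfolding level_gap_def[of _ _ _ "Suc n"] by (intro sum_mono)
  also have "\<dots> = (real CARD('q))\<^sup>2 * (d * exp (- d * \<gamma>) * ?M) * ?g"
    by (simp add: power2_eq_square)
  finally show ?thesis .
qed

text \<open>From \<open>exp x \<ge> x\<^sup>2 / 2\<close>. The decay in \<open>y\<close> makes the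
  contraction factor small once \<open>y\<close> exceeds a constant.\<close>

lemma times_exp_neg_le:
  assumes "0 < c" "0 < (y :: real)"
  shows "y * exp (- (c * y)) \<le> 2 / (c\<^sup>2 * y)"
proof -
  have "(c * y)\<^sup>2 / 2 \<le> exp (c * y)"
    using exp_lower_Taylor_quadratic[of "c * y"] mult_pos_pos[OF assms] by linarith
  then have "exp (- (c * y)) \<le> 2 / (c * y)\<^sup>2"
    using assms by (simp add: exp_minus field_simps)
  from mult_left_mono[OF this, of y] show ?thesis
    using assms by (simp add: power2_eq_square)
qed

text \<open>Halving is asked for only eventually, because the census estimator is accurate only on
  deep levels.\<close>

lemma tendsto_zero_if_eventually_halved:
  fixes g :: "nat \<Rightarrow> real"
  assumes "\<And>n. 0 \<le> g n" "\<forall>\<^sub>F n in sequentially. g (Suc n) \<le> g n / 2"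
  shows "g \<longlonglongrightarrow> 0"
proof -
  obtain N where N: "\<And>n. n \<ge> N \<Longrightarrow> g (Suc n) \<le> g n / 2"
    using assms(2) unfolding eventually_sequentially by blast
  have "g (m + N) \<le> g N * (1 / 2) ^ m" for m
  proof (induction m)
    case (Suc m)
    have "g (Suc m + N) \<le> g (m + N) / 2"
      using N[of "m + N"] by simp
    also have "\<dots> \<le> g N * (1 / 2) ^ m / 2"
      using Suc by simp
    finally show ?case by simp
  qed simp
  moreover have "(\<lambda>m. g N * (1 / 2) ^ m) \<longlonglongrightarrow> 0"
    by (intro tendsto_mult_right_zero LIMSEQ_power_zero) simp
  ultimately have "(\<lambda>m. g (m + N)) \<longlonglongrightarrow> 0"
    by - (rule tendsto_sandwich[OF _ _ tendsto_const], auto simp: assms(1))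
  then show ?thesis by (rule LIMSEQ_offset)
qed

theorem proposition1p16:
  fixes \<pi> :: "'q :: {finite, linorder} pmf" and \<delta> :: real
  assumes "CARD('q) \<ge> 2" and "\<forall>i. pmf \<pi> i > 0" and "\<delta> > 0"
  shows "\<exists>C :: real. \<forall>\<xi> :: real. \<xi> > 0 \<longrightarrow> (\<exists>C1 :: real.
    \<forall>(d :: real) (P :: 'q rmat) (U :: 'q rmat) (l :: 'q rvec) (\<Delta> :: 'q rmat).
      d > 0 \<longrightarrow>
      stochastic_matrix P \<longrightarrow>
      reversible \<pi> P \<longrightarrow>
      spectral_decomposition \<pi> P U l \<longrightarrow>
      l $ nth_index 1 = 1 \<longrightarrow>
      (\<forall>i j. i \<le> j \<longrightarrow> l $ j \<le> l $ i) \<longrightarrow>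
      (\<forall>i. l $ i \<ge> 0) \<longrightarrow>
      (\<forall>i j. i \<noteq> j \<longrightarrow>
        (\<Sum>k\<in>UNIV. \<bar>P $ i $ k - P $ j $ k\<bar>) \<ge> \<delta> * CARD('q) * l $ nth_index 2) \<longrightarrow>
      (\<forall>i j. P $ i $ j > \<xi>) \<longrightarrow>
      stochastic_matrix \<Delta> \<longrightarrow>
      invertible \<Delta> \<longrightarrow>
      2 * sqrt 2 * (MAX k. pmf \<pi> k powr (3/2)) * (MAX k. pmf \<pi> k powr (-3/2)) / \<xi> ^ 3
        * l $ nth_index 2 < \<delta>\<^sup>2 * (real CARD('q))\<^sup>2 / 8 \<longrightarrow>
      (l $ nth_index 2)\<^sup>2 * d > C1 \<longrightarrow>
      distinguishable \<delta> {eigvec \<pi> U i | i. (l $ i)\<^sup>2 * d > C} \<longrightarrow>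
      (\<forall>i j. (\<lambda>n. measure_pmf.expectation (cond_pmf (broadcast \<pi> d P \<Delta> n) {t. fst (root t) = j})
            (\<lambda>t. X_root \<pi> d P \<Delta> n i t - X_noisy \<pi> d P \<Delta> n i t)) \<longlonglongrightarrow> 0))"
proof -
  define a where "a = Min (range (pmf \<pi>))"
  define q where "q = real CARD('q)"
  \<comment> \<open>The constant of \<open>kernel_row_diff\<close>, apart from the
    eigenvalue.\<close>
  define \<kappa> where "\<kappa> = 2 * q / a"
  \<comment> \<open>Makes the error \<open>2 * \<kappa>\<^sup>2 * q\<^sup>2 * \<epsilon>\<close> in
    \<open>bhattacharyya_mixture_le\<close> half of \<open>\<delta>\<^sup>2 * q\<^sup>2\<close>; the
    other half times \<open>a / 8\<close> is \<open>c\<close>.\<close>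
  define \<epsilon> where "\<epsilon> = \<delta>\<^sup>2 / (4 * \<kappa>\<^sup>2)"
  define c where "c = a * \<delta>\<^sup>2 * q\<^sup>2 / 16"
  \<comment> \<open>The second entry brings the bound of \<open>level_law_distinguishable\<close>
    with \<open>b = 1 / a\<close> down to \<open>\<epsilon>\<close>; the 2 is the threshold of the
    census recursion.\<close>
  define C where "C = max 2 (12 * (1 / a) / (\<delta>\<^sup>2 * \<epsilon>\<^sup>2))"
  have a: "0 < a" "\<And>i. a \<le> pmf \<pi> i"
    using assms(2) by (auto simp: a_def)
  have q: "0 < q"
    using assms(1) by (simp add: q_def)
  have \<kappa>: "0 < \<kappa>"
    using a q by (simp add: \<kappa>_def)
  have \<epsilon>: "0 < \<epsilon>"
    using \<kappa> assms(3) by (simp add: \<epsilon>_def)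
  have c: "0 < c"
    using a q assms(3) by (simp add: c_def)
  have C: "2 \<le> C" "2 * sqrt (3 * (1 / a) / C) / \<delta> \<le> \<epsilon>"
  proof -
    show "2 \<le> C" by (simp add: C_def)
    have "12 * (1 / a) / (\<delta>\<^sup>2 * \<epsilon>\<^sup>2) \<le> C" by (simp add: C_def)
    then have "3 * (1 / a) / C \<le> (\<delta> * \<epsilon> / 2)\<^sup>2"
      using a \<epsilon> assms(3) \<open>2 \<le> C\<close> by (simp add: power_divide power_mult_distrib field_simps)
    then have "sqrt (3 * (1 / a) / C) \<le> \<delta> * \<epsilon> / 2"
      using \<epsilon> assms(3) by (intro real_le_lsqrt) auto
    then have "2 * sqrt (3 * (1 / a) / C) \<le> 2 * (\<delta> * \<epsilon> / 2)"
      by (rule mult_left_mono) simp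
    also have "\<dots> = \<epsilon> * \<delta>" by simp
    finally show "2 * sqrt (3 * (1 / a) / C) / \<delta> \<le> \<epsilon>"
      unfolding pos_divide_le_eq[OF assms(3)] .
  qed
  show ?thesis
  proof (rule exI[of _ C], rule allI, rule impI, goal_cases)
    case \<xi>: (1 \<xi>)
    \<comment> \<open>\<open>B\<close> is the last factor in \<open>level_gap_Suc_le\<close> with
      the squared eigenvalue taken out; \<open>C1\<close> solves
      \<open>q\<^sup>2 * B * (2 / (c\<^sup>2 * C1)) = 1 / 2\<close>.\<close>
    define B where "B = 4 * (q / a)\<^sup>2 * q / (a\<^sup>2 * \<xi> ^ 3)"
    define C1 where "C1 = 4 * q\<^sup>2 * B / c\<^sup>2"
    have B: "0 < B"
      using a q \<xi> by (simp add: B_def)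
    then have C1: "0 < C1"
      using q c by (simp add: C1_def)
    show ?case
    proof (rule exI[of _ C1], intro allI impI)
      fix d :: real and P U :: "'q rmat" and l :: "'q rvec" and \<Delta> :: "'q rmat" and i j :: 'q
      assume d: "d > 0" and P: "stochastic_matrix P" and rev: "reversible \<pi> P"
        and spec: "spectral_decomposition \<pi> P U l"
        and l1: "l $ nth_index 1 = 1" and l_mono: "\<forall>i j. i \<le> j \<longrightarrow> l $ j \<le> l $ i" and l_nonneg: "\<forall>i. l $ i \<ge> 0"
        and rows: "\<forall>i j. i \<noteq> j \<longrightarrow> (\<Sum>k\<in>UNIV. \<bar>P $ i $ k - P $ j $ k\<bar>) \<ge> \<delta> * CARD('q) * l $ nth_index 2"
        and P_gt: "\<forall>i j. P $ i $ j > \<xi>" and \<Delta>: "stochastic_matrix \<Delta>" "invertible \<Delta>"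
        and large: "(l $ nth_index 2)\<^sup>2 * d > C1"
        and dist: "distinguishable \<delta> {eigvec \<pi> U i | i. (l $ i)\<^sup>2 * d > C}"
      let ?l2 = "l $ nth_index 2" and ?W = "level_law fst d P \<Delta>" and ?W' = "level_law snd d P \<Delta>"
      have full: "0 < pmf \<pi> i" for i
        using assms(2) by simp
      have P_pos: "0 < P $ i $ j" for i j
        using P_gt \<xi> by (meson less_trans)
      note hyps = a rev spec assms(1) P P_pos l1 l_mono[rule_format] l_nonneg[rule_format]
      \<comment> \<open>Each pair of labels uses an eigenvector that distinguishes it; finitely many
        pairs admit a common threshold for \<open>n\<close>.\<close>
      have accurate: "\<forall>\<^sub>F n in sequentially. \<forall>i j. i \<noteq> j \<longrightarrow> bhattacharyya (?W' n i) (?W' n j) \<le> \<epsilon>"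
      proof (intro eventually_all_finite allI)
        fix i j
        show "\<forall>\<^sub>F n in sequentially. i \<noteq> j \<longrightarrow> bhattacharyya (?W' n i) (?W' n j) \<le> \<epsilon>"
        proof (cases "i = j")
          case False
          then obtain k where k: "(l $ k)\<^sup>2 * d > C" "\<bar>eigvec \<pi> U k $ i - eigvec \<pi> U k $ j\<bar> > \<delta>"
            using dist unfolding distinguishable_def by blast
          have "\<forall>\<^sub>F n in sequentially. bhattacharyya (?W' n i) (?W' n j) \<le> 2 * sqrt (3 * (1 / a) / C) / \<delta>"
            using a k assms(3) C(1)
            by (intro level_law_distinguishable[where v = "\<lambda>i. eigvec \<pi> U k $ i" and \<mu> = "l $ k"] d P \<Delta>
                eigvec_eigenvector[OF a rev spec] eigvec_square_le[OF a rev spec]) auto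
          then show ?thesis
            by eventually_elim (use C(2) in auto)
        qed simp
      qed
      have halved: "\<forall>\<^sub>F n in sequentially. level_gap d P \<Delta> (Suc n) \<le> level_gap d P \<Delta> n / 2"
        using accurate
      proof eventually_elim
        case (elim n)
        \<comment> \<open>The separation and the variation of the rows both scale with
          \<open>?l2\<close>, so \<open>?l2\<^sup>2\<close> factors out of the lower bound.\<close>
        have sep: "c * ?l2\<^sup>2 \<le> 1 - bhattacharyya (bind_pmf (row_pmf P i) (?W' n)) (bind_pmf (row_pmf P j) (?W' n))"
          if "i \<noteq> j" for i j
        proof -
          have "a / 8 * ((\<delta> * q * ?l2)\<^sup>2 - 2 * (\<kappa> * ?l2)\<^sup>2 * (real CARD('q))\<^sup>2 * \<epsilon>)
              \<le> 1 - bhattacharyya (bind_pmf (row_pmf P i) (?W' n)) (bind_pmf (row_pmf P j) (?W' n))"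
          proof (rule bhattacharyya_mixture_le[OF full a])
            show "\<bar>pmf (row_pmf P i) k - pmf (row_pmf P j) k\<bar> / pmf \<pi> k \<le> \<kappa> * ?l2" for k
              using kernel_row_diff[OF hyps, of i k j] by (simp add: pmf_row_pmf[OF P] \<kappa>_def q_def)
          qed (use rows that elim \<epsilon> q assms(3) l_nonneg in \<open>auto simp: pmf_row_pmf[OF P] q_def\<close>)
          also have "a / 8 * ((\<delta> * q * ?l2)\<^sup>2 - 2 * (\<kappa> * ?l2)\<^sup>2 * (real CARD('q))\<^sup>2 * \<epsilon>) = c * ?l2\<^sup>2"
            using \<kappa> by (simp add: c_def \<epsilon>_def q_def[symmetric] power_mult_distrib field_simps)
          finally show ?thesis .
        qed
        \<comment> \<open>The factor \<open>d\<close> and the squared eigenvalue of the contraction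
          combine to \<open>y\<close>, and the exponent is \<open>- (c * y)\<close>, so the whole
          factor depends on \<open>d\<close> and \<open>?l2\<close> only through
          \<open>y\<close>.\<close>
        define y where "y = ?l2\<^sup>2 * d"
        have y: "C1 < y" "0 < y"
          using large C1 by (auto simp: y_def)
        have "level_gap d P \<Delta> (Suc n) \<le> q\<^sup>2 * (d * exp (- d * (c * ?l2\<^sup>2)) *
            (4 * (?l2 * q / a)\<^sup>2 * q / (a\<^sup>2 * \<xi> ^ 3))) * level_gap d P \<Delta> n"
          unfolding q_def
        proof (rule level_gap_Suc_le[OF d a P \<xi>])
          show "\<xi> \<le> P $ i $ j" for i j
            using P_gt by (simp add: less_imp_le)
          show "0 \<le> ?l2 * real CARD('q) / a"
            using a l_nonneg by simp
        qed (use sep kernel_contraction[OF hyps] in auto)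
        also have "q\<^sup>2 * (d * exp (- d * (c * ?l2\<^sup>2)) * (4 * (?l2 * q / a)\<^sup>2 * q / (a\<^sup>2 * \<xi> ^ 3))) =
            q\<^sup>2 * B * (y * exp (- (c * y)))"
          by (simp add: B_def y_def power_mult_distrib power_divide ac_simps)
        also have "\<dots> \<le> 1 / 2"
        proof -
          have "q\<^sup>2 * B * (y * exp (- (c * y))) \<le> q\<^sup>2 * B * (2 / (c\<^sup>2 * y))"
            using times_exp_neg_le[OF c y(2)] B by (intro mult_left_mono) auto
          also have "\<dots> \<le> q\<^sup>2 * B * (2 / (c\<^sup>2 * C1))"
            using y C1 c B by (intro mult_left_mono divide_left_mono mult_pos_pos) auto
          also have "\<dots> = 1 / 2"
            using q B c by (simp add: C1_def field_simps)
          finally show ?thesis .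
        qed
        finally show ?case
          using level_gap_nonneg[of d P \<Delta> n] by (simp add: mult_right_mono)
      qed
      let ?E = "\<lambda>n. measure_pmf.expectation (cond_pmf (broadcast \<pi> d P \<Delta> n) {t. fst (root t) = j})
            (\<lambda>t. X_root \<pi> d P \<Delta> n i t - X_noisy \<pi> d P \<Delta> n i t)"
      \<comment> \<open>The gap controls the squared expectation, and a square root transfers the
        limit.\<close>
      have "(?E n)\<^sup>2 \<le> 8 / a * level_gap d P \<Delta> n" for n
      proof -
        obtain K where K: "?W' n = (\<lambda>i. bind_pmf (?W n i) K)" "level_gap d P \<Delta> n = bhattacharyya_gap (?W n) K"
          by (rule obtain_noise_kernel)
        show ?thesis
          unfolding expectation_posterior_diff[OF full] K
          by (rule posterior_expectation_diff_le[OF full a])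
      qed
      moreover have "(\<lambda>n. 8 / a * level_gap d P \<Delta> n) \<longlonglongrightarrow> 0"
        by (intro tendsto_mult_right_zero tendsto_zero_if_eventually_halved level_gap_nonneg halved)
      ultimately have "(\<lambda>n. (?E n)\<^sup>2) \<longlonglongrightarrow> 0"
        by - (rule tendsto_sandwich[OF _ _ tendsto_const], auto)
      from tendsto_real_sqrt[OF this] show "?E \<longlonglongrightarrow> 0"
        by (simp add: tendsto_rabs_zero_iff)
    qed
  qed
qed

end
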